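(* Let $d\ge 1$ and, for each integer $L\ge 0$, let $\mathcal{Z}(L)=\{z_{L1},\dots,z_{L,\pi_L}\}\subset\mathbb{S}^d$ be a set of Fekete points of degree $L$ for $\mathbb{S}^d$. Given $0<\varepsilon<1$, let $L_{-\varepsilon}=[(1-\varepsilon)L]$ and $$\mathcal{Z}_{-\varepsilon}(L)=\mathcal{Z}(L_{-\varepsilon})=\{z_{L_{-\varepsilon},1},\dots,z_{L_{-\varepsilon},\pi_{L_{-\varepsilon}}}\}.$$ Then the array $\mathcal{Z}_{-\varepsilon}=\{\mathcal{Z}_{-\varepsilon}(L)\}_{L\ge 0}$ is $L^p$-interpolating for every $1\le p\le\infty$.
   Context: $\mathbb{S}^d$ is the unit sphere in $\mathbb{R}^{d+1}$ and $\sigma$ is its Lebesgue surface measure; $[x]$ is the integer part of $x$. $\Pi_L$ is the space of (complex-valued) spherical harmonics of degree not exceeding $L$ on $\mathbb{S}^d$ (equivalently, the restrictions to $\mathbb{S}^d$ of polynomials in $d+1$ variables of degree at most $L$), and $\pi_L=\dim\Pi_L=\frac{d+2L}{d}\binom{d+L-1}{L}$. Fekete points: let $\{Q_1^L,\dots,Q_{\pi_L}^L\}$ be any basis of $\Pi_L$. A set of Fekete points of degree $L$ for $\mathbb{S}^d$ is a set of points $\{z_{L1},\dots,z_{L,\pi_L}\}\subset\mathbb{S}^d$ such that $(z_{L1},\dots,z_{L,\pi_L})$ maximizes $|\Delta(x_1,\dots,x_{\pi_L})|=|\det(Q_i^L(x_j))_{i,j}|$ over all $(x_1,\dots,x_{\pi_L})\in(\mathbb{S}^d)^{\pi_L}$.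 (This does not depend on the choice of basis.) Triangular array: a family $\mathcal{Z}=\{\mathcal{Z}(L)\}_{L\ge 0}$ of finite sets $\mathcal{Z}(L)=\{z_{Lj}\in\mathbb{S}^d:1\le j\le m_L\}$ with $m_L\to\infty$ as $L\to\infty$. Interpolating array: a triangular array $\mathcal{Z}$ with $m_L\le\pi_L$ for all $L$ is $L^p$-interpolating if for every array $\{c_{Lj}\}_{L\ge 0,\,1\le j\le m_L}$ of complex values with $$\sup_{L\ge 0}\frac{1}{\pi_L}\sum_{j=1}^{m_L}|c_{Lj}|^p<\infty$$ (for $p=\infty$: $\sup_{L\ge 0}\sup_{1\le j\le m_L}|c_{Lj}|<\infty$) there exists a sequence of polynomials $Q_L\in\Pi_L$, uniformly bounded in $L^p(\mathbb{S}^d,\sigma)$, such that $Q_L(z_{Lj})=c_{Lj}$ for all $L\ge 0$ and $1\le j\le m_L$. Here, for the array $\mathcal{Z}_{-\varepsilon}$, the $L$-th generation is $\mathcal{Z}(L_{-\varepsilon})$, so $m_L=\pi_{L_{-\varepsilon}}$. *)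

theory Defs
  imports
    "HOL-Probability.Essential_Supremum"
    "HOL-Library.Function_Algebras"
    "Jordan_Normal_Form.Determinant"
begin

text \<open>
  The ambient space of dimension \<open>d + 1\<close> is a type \<open>'a::euclidean_space\<close> with \<open>DIM('a) = d + 1\<close>;
  the unit sphere of dimension \<open>d\<close> is \<open>sphere (0::'a) 1\<close>.
\<close>

text \<open>
  The surface measure of \<open>A\<close> is \<open>d + 1\<close> times the volume of the cone
  \<open>{t *\<^sub>R x | 0 < t < 1 \<and> x \<in> A}\<close> (polar coordinates). Note that \<open>sgn x = x /\<^sub>R norm x\<close>; the exceptional
  point \<open>sgn 0 = 0\<close> is removed by the final restriction to the sphere.
\<close>

definition sphere_measure :: "'a::euclidean_space measure" where
  "sphere_measure =
     restrict_space
       (scale_measure (of_nat DIM('a)) (distr (restrict_space lborel (ball 0 1)) borel sgn))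
       (sphere 0 1)"

definition Lp_norm :: "'a measure \<Rightarrow> ennreal \<Rightarrow> ('a \<Rightarrow> complex) \<Rightarrow> ennreal" where
  "Lp_norm M p f =
     (if p = \<infinity> then esssup M (\<lambda>x. ennreal (norm (f x)))
      else let I = (\<integral>\<^sup>+ x. ennreal (norm (f x) powr enn2real p) \<partial>M)
           in if I = \<infinity> then \<infinity> else ennreal (enn2real I powr (1 / enn2real p)))"

definition scale_fun :: "complex \<Rightarrow> ('a \<Rightarrow> complex) \<Rightarrow> ('a \<Rightarrow> complex)" where
  "scale_fun c f = (\<lambda>x. c * f x)"

global_interpretation cfun: vector_space "scale_fun :: complex \<Rightarrow> ('a \<Rightarrow> complex) \<Rightarrow> ('a \<Rightarrow> complex)"
  by unfold_locales (auto simp: scale_fun_def fun_eq_iff algebra_simps)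

definition monomial_fun :: "('a::euclidean_space \<Rightarrow> nat) \<Rightarrow> 'a \<Rightarrow> complex" where
  "monomial_fun \<alpha> = (\<lambda>x. \<Prod>b\<in>Basis. complex_of_real (inner x b) ^ \<alpha> b)"

definition poly_funs :: "nat \<Rightarrow> ('a::euclidean_space \<Rightarrow> complex) set" where
  "poly_funs L = cfun.span {monomial_fun \<alpha> | \<alpha>. (\<Sum>b\<in>Basis. \<alpha> b) \<le> L}"

text \<open>
  Functions on the sphere are represented by their extension by \<open>0\<close> to the ambient space, so that
  equality and linear independence refer to the values on the sphere only.
\<close>

definition sphere_restrict :: "('a::euclidean_space \<Rightarrow> complex) \<Rightarrow> 'a \<Rightarrow> complex" where
  "sphere_restrict f = (\<lambda>x. if x \<in> sphere 0 1 then f x else 0)"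

definition sphere_polys :: "nat \<Rightarrow> ('a::euclidean_space \<Rightarrow> complex) set" where
  "sphere_polys L = sphere_restrict ` poly_funs L"

definition sphere_dim :: "'a::euclidean_space itself \<Rightarrow> nat \<Rightarrow> nat" where
  "sphere_dim _ L = cfun.dim (sphere_polys L :: ('a \<Rightarrow> complex) set)"

text \<open>Indices run over \<open>0, \<dots>, n - 1\<close> instead of \<open>1, \<dots>, n\<close> throughout.\<close>

definition sphere_basis :: "nat \<Rightarrow> (nat \<Rightarrow> 'a::euclidean_space \<Rightarrow> complex) \<Rightarrow> bool" where
  "sphere_basis L Q \<longleftrightarrow>
     inj_on Q {..<sphere_dim TYPE('a) L} \<and>
     cfun.independent (Q ` {..<sphere_dim TYPE('a) L}) \<and>
     cfun.span (Q ` {..<sphere_dim TYPE('a) L}) = sphere_polys L"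

definition fekete_det ::
    "nat \<Rightarrow> (nat \<Rightarrow> 'a::euclidean_space \<Rightarrow> complex) \<Rightarrow> (nat \<Rightarrow> 'a) \<Rightarrow> complex" where
  "fekete_det L Q x =
     Determinant.det (Matrix.mat (sphere_dim TYPE('a) L) (sphere_dim TYPE('a) L) (\<lambda>(i, j). Q i (x j)))"

text \<open>
  The choice of the basis is immaterial: a change of basis multiplies the determinant by a nonzero
  constant.
\<close>

definition fekete_points :: "nat \<Rightarrow> (nat \<Rightarrow> 'a::euclidean_space) \<Rightarrow> bool" where
  "fekete_points L z \<longleftrightarrow>
     (\<forall>j < sphere_dim TYPE('a) L. z j \<in> sphere 0 1) \<and>
     (\<exists>Q. sphere_basis L Q \<and>
        (\<forall>x. (\<forall>j < sphere_dim TYPE('a) L. x j \<in> sphere 0 1) \<longrightarrow>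
             norm (fekete_det L Q x) \<le> norm (fekete_det L Q z)))"

definition triangular_array :: "(nat \<Rightarrow> nat) \<Rightarrow> (nat \<Rightarrow> nat \<Rightarrow> 'a::euclidean_space) \<Rightarrow> bool" where
  "triangular_array m z \<longleftrightarrow>
     (\<forall>L. \<forall>j < m L. z L j \<in> sphere 0 1) \<and>
     (\<forall>L. inj_on (z L) {..<m L}) \<and>
     filterlim m at_top at_top"

definition Lp_bounded_values ::
    "'a::euclidean_space itself \<Rightarrow> ennreal \<Rightarrow> (nat \<Rightarrow> nat) \<Rightarrow> (nat \<Rightarrow> nat \<Rightarrow> complex) \<Rightarrow> bool" where
  "Lp_bounded_values _ p m c \<longleftrightarrow>
     (if p = \<infinity> then (SUP L. SUP j\<in>{..<m L}. ennreal (norm (c L j))) < \<infinity>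
      else (SUP L. ennreal ((\<Sum>j<m L. norm (c L j) powr enn2real p) / real (sphere_dim TYPE('a) L))) < \<infinity>)"

definition Lp_interpolating :: "ennreal \<Rightarrow> (nat \<Rightarrow> nat) \<Rightarrow> (nat \<Rightarrow> nat \<Rightarrow> 'a::euclidean_space) \<Rightarrow> bool" where
  "Lp_interpolating p m z \<longleftrightarrow>
     triangular_array m z \<and>
     (\<forall>L. m L \<le> sphere_dim TYPE('a) L) \<and>
     (\<forall>c. Lp_bounded_values TYPE('a) p m c \<longrightarrow>
        (\<exists>Q. (\<forall>L. Q L \<in> sphere_polys L) \<and>
             (SUP L. Lp_norm sphere_measure p (Q L)) < \<infinity> \<and>
             (\<forall>L. \<forall>j < m L. Q L (z L j) = c L j)))"

definition deg_minus :: "real \<Rightarrow> nat \<Rightarrow> nat" where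
  "deg_minus \<epsilon> L = nat \<lfloor>(1 - \<epsilon>) * real L\<rfloor>"

end

theory Submission
  imports
    Defs
    "HOL-Probability.Sinc_Integral"
    "HOL-Complex_Analysis.Complex_Analysis"
begin

text \<open>
  Let \<open>k = deg_minus \<epsilon> L\<close> and let \<open>y\<^sub>1, \<dots>, y\<^sub>m\<close> be Fekete points of degree \<open>k\<close>. The maximality of the
  determinant gives Lagrange functions \<open>l\<^sub>j\<close> of degree \<open>k\<close> that are bounded by \<open>1\<close> on the whole sphere.
  The sum \<open>\<Sum>\<^sub>j c\<^sub>j l\<^sub>j\<close> interpolates, but many \<open>l\<^sub>j\<close> may be close to \<open>1\<close> in modulus at the same point. The gap \<open>L - k \<ge> \<epsilon> L\<close> between the
  degrees leaves room to multiply \<open>l\<^sub>j\<close> by a zonal polynomial \<open>K(x \<bullet> y\<^sub>j)\<close> that equals \<open>1\<close> at \<open>y\<^sub>j\<close> and is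
  concentrated at distance \<open>O(1/L)\<close> from \<open>y\<^sub>j\<close>: with \<open>D = d + 1\<close> and \<open>n\<close> comparable to \<open>L\<close>, the
  \<open>D\<close>-th power of the normalized Fejer kernel of order \<open>n\<close> satisfies
  \<open>0 \<le> K(x \<bullet> y) \<le> W(x, y)\<close> with \<open>W(x, y) = (5 / (1 + (n \<bar>x - y\<bar>)\<^sup>2)) ^ D\<close>. The interpolant is
  \<open>Q(x) = \<Sum>\<^sub>j c\<^sub>j K(x \<bullet> y\<^sub>j) l\<^sub>j(x)\<close>, and \<open>\<bar>Q(x)\<bar> \<le> \<Sum>\<^sub>j \<bar>c\<^sub>j\<bar> W(x, y\<^sub>j)\<close> on the sphere.

  Two bounds on the weights \<open>W\<close>, uniform in \<open>L\<close>, finish the proof by Jensen's inequality: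
  \<open>\<Sum>\<^sub>j W(x, y\<^sub>j) \<le> A\<close> for all \<open>x\<close>, and \<open>\<integral> W(x, y\<^sub>j) d\<sigma>(x) \<le> B / \<pi>\<^sub>L\<close> for all \<open>j\<close>
  (lemma \<open>localized_interpolation\<close>).

  The first bound holds because Fekete points of degree \<open>k\<close> are separated by a multiple of
  \<open>1 / (k + 1)\<close> (lemma \<open>fekete_separated\<close>). Indeed \<open>l\<^sub>i\<close>, restricted to a great circle, is a
  trigonometric polynomial bounded by \<open>1\<close>, and such a function cannot drop from \<open>1\<close> to \<open>0\<close> over a
  short arc. Since \<open>W\<close> is dominated by a product of one-dimensional summable profiles, its sum over a
  separated set is dominated by a lattice sum (lemma \<open>separated_decay_sum\<close>).

  For the second bound, the integral is \<open>O(n powr (1 - D))\<close> by a comparison with integrals over the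
  ambient space (lemma \<open>sphere_decay_integral\<close>), and \<open>\<pi>\<^sub>L = O(n ^ (D - 1))\<close>. The latter again
  follows from separation: the \<open>\<pi>\<^sub>L\<close> Fekete points of degree \<open>L\<close> are centres of disjoint balls of radius
  comparable to \<open>1/L\<close> in a thin shell around the sphere (lemma \<open>card_separated_sphere\<close>).
\<close>

section \<open>Sums of a decaying profile over separated sets\<close>

text \<open>
  The product form makes lattice sums and volume integrals of the profile split into one-dimensional
  factors.
\<close>

definition decay :: "'a::euclidean_space \<Rightarrow> real" where
  "decay x = (\<Prod>b\<in>Basis. 1 / (1 + (inner x b)\<^sup>2))"

text \<open>
  Each coordinate is at most the norm, so the radial profile of exponent \<open>DIM('a)\<close> lies below the
  product profile. This exponent is why the kernel below is raised to the power \<open>DIM('a)\<close>.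
\<close>

lemma decay_ge: "(1 / (1 + (norm x)\<^sup>2)) ^ DIM('a) \<le> decay (x::'a::euclidean_space)"
proof -
  have "(\<Prod>b\<in>(Basis::'a set). 1 / (1 + (norm x)\<^sup>2)) \<le> decay x"
    unfolding decay_def
  proof (intro prod_mono conjI)
    fix b :: 'a assume b: "b \<in> Basis"
    have "(inner x b)\<^sup>2 \<le> (norm x)\<^sup>2"
      using Basis_le_norm[OF b, of x] by (simp flip: abs_le_square_iff)
    then show "1 / (1 + (norm x)\<^sup>2) \<le> 1 / (1 + (inner x b)\<^sup>2)"
      by (intro divide_left_mono) (auto intro!: mult_pos_pos add_pos_nonneg)
  qed auto
  then show ?thesis by simp
qed

lemma sum_inverse_1_plus_square_le:
  "(\<Sum>k\<in>{-int M..int M}. 1 / (1 + (real_of_int k)\<^sup>2)) \<le> 5"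
proof -
  define S where "S = (\<lambda>M. \<Sum>k\<in>{-int M..int M}. 1 / (1 + (real_of_int k)\<^sup>2))"
  have S_Suc: "S (Suc M) = S M + 2 / (1 + (real (Suc M))\<^sup>2)" for M
  proof -
    have eq: "{-int (Suc M)..int (Suc M)} = insert (int (Suc M)) (insert (- int (Suc M)) {-int M..int M})"
      by auto
    show ?thesis
      unfolding S_def eq by (subst sum.insert; (subst sum.insert)?) (auto simp: power2_eq_square algebra_simps)
  qed
  have "S (Suc M) \<le> 5 - 2 / real (Suc M)" for M
  proof (induction M)
    case (Suc M)
    have "2 / (1 + (real (Suc (Suc M)))\<^sup>2) \<le> 2 / (real (Suc M) * real (Suc (Suc M)))"
      by (intro divide_left_mono) (auto simp: power2_eq_square algebra_simps intro!: add_pos_nonneg mult_pos_pos)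
    also have "\<dots> = 2 / real (Suc M) - 2 / real (Suc (Suc M))"
      by (simp add: field_simps)
    finally show ?case using Suc S_Suc[of "Suc M"] by simp
  qed (simp add: S_Suc, simp add: S_def)
  then have "S (Suc M) \<le> 5" for M
    by (rule order.trans) simp
  moreover have "S 0 \<le> 5" by (simp add: S_def)
  ultimately have "S M \<le> 5" by (cases M) auto
  then show ?thesis by (simp add: S_def)
qed

text \<open>
  Rounding the points to a lattice of mesh \<open>c / DIM('a)\<close> sends different points to different lattice
  points and changes each factor of \<open>decay\<close> by a bounded factor only. The sum is therefore controlled by a
  sum over a box of integer vectors, which is a power of a one-dimensional sum.
\<close>

lemma separated_decay_sum:
  fixes y :: "'i \<Rightarrow> 'a::euclidean_space"
  assumes "finite J" "c > 0"
    and sep: "\<And>i j. i \<in> J \<Longrightarrow> j \<in> J \<Longrightarrow> i \<noteq> j \<Longrightarrow> c \<le> dist (y i) (y j)"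
  shows "(\<Sum>j\<in>J. decay (y j)) \<le> (5 * (3 + 2 * (DIM('a) / c)\<^sup>2)) ^ DIM('a)"
proof -
  define s where "s = DIM('a) / c"
  have s: "s > 0" using assms by (simp add: s_def)
  define A where "A = 3 + 2 * s\<^sup>2"
  have A: "A > 0" by (simp add: A_def add_pos_nonneg)
  define k where "k = (\<lambda>j. restrict (\<lambda>b. \<lfloor>s * inner (y j) b\<rfloor>) (Basis::'a set))"
  define g :: "int \<Rightarrow> real" where "g = (\<lambda>m. 1 / (1 + (real_of_int m)\<^sup>2))"
  have g0: "g m \<ge> 0" for m by (simp add: g_def)
  \<comment> \<open>Two points in the same cell are closer than \<open>c\<close>, measured in the \<open>l\<^sup>1\<close> norm.\<close>
  have inj: "inj_on k J"
  proof (rule inj_onI, rule ccontr)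
    fix i j assume ij: "i \<in> J" "j \<in> J" "k i = k j" "i \<noteq> j"
    have "\<bar>inner (y i - y j) b\<bar> < 1 / s" if b: "b \<in> Basis" for b
    proof -
      have "\<lfloor>s * inner (y i) b\<rfloor> = \<lfloor>s * inner (y j) b\<rfloor>"
        using fun_cong[OF ij(3), of b] b by (simp add: k_def)
      then have "\<bar>s * inner (y i) b - s * inner (y j) b\<bar> < 1" by linarith
      then have "s * \<bar>inner (y i - y j) b\<bar> < 1"
        using s by (simp add: abs_mult inner_diff_left flip: right_diff_distrib)
      then show ?thesis using s by (simp add: field_simps)
    qed
    then have "(\<Sum>b\<in>Basis. \<bar>inner (y i - y j) b\<bar>) < (\<Sum>b\<in>(Basis::'a set). 1 / s)"
      by (intro sum_strict_mono) auto
    then have "dist (y i) (y j) < DIM('a) / s"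
      using norm_le_l1[of "y i - y j"] by (simp add: dist_norm)
    also have "DIM('a) / s = c" using assms by (simp add: s_def)
    finally show False using sep[OF ij(1,2,4)] by simp
  qed
  \<comment> \<open>Rounding \<open>s * t\<close> down costs at most \<open>1\<close>, hence at most the constant factor \<open>A\<close>.\<close>
  have pt: "1 / (1 + t\<^sup>2) \<le> A * g \<lfloor>s * t\<rfloor>" for t :: real
  proof -
    define m where "m = real_of_int \<lfloor>s * t\<rfloor>"
    have "\<bar>m\<bar> \<le> \<bar>s * t\<bar> + 1" unfolding m_def by linarith
    then have "m\<^sup>2 \<le> (\<bar>s * t\<bar> + 1)\<^sup>2" by (metis abs_ge_zero abs_of_nonneg power2_abs power_mono)
    also have "\<dots> \<le> 2 * (s * t)\<^sup>2 + 2"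
      using sum_squares_ge_zero[of "\<bar>s*t\<bar> - 1" 0] 
      by (simp add: power2_eq_square algebra_simps flip: power2_abs[of "s*t"])
    finally have "1 + m\<^sup>2 \<le> A * (1 + t\<^sup>2)"
      by (simp add: A_def algebra_simps power_mult_distrib)
         (smt (verit) zero_le_power2)
    then show ?thesis
      by (simp add: g_def flip: m_def) (simp add: field_simps add_pos_nonneg)
  qed
  have "\<exists>M::nat. \<forall>j\<in>J. \<forall>b\<in>Basis. \<bar>\<lfloor>s * inner (y j) b\<rfloor>\<bar> \<le> int M"
  proof -
    have fin: "finite ((\<lambda>(j,b). nat \<bar>\<lfloor>s * inner (y j) b\<rfloor>\<bar>) ` (J \<times> Basis))"
      using assms by simp
    then obtain M where "\<forall>x\<in>(\<lambda>(j,b). nat \<bar>\<lfloor>s * inner (y j) b\<rfloor>\<bar>) ` (J \<times> Basis). x \<le> M"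
      using finite_nat_set_iff_bounded_le by blast
    then show ?thesis by (intro exI[of _ M]) force
  qed
  then obtain M :: nat where M: "\<And>j b. j \<in> J \<Longrightarrow> b \<in> Basis \<Longrightarrow> \<bar>\<lfloor>s * inner (y j) b\<rfloor>\<bar> \<le> int M"
    by blast
  have sub: "k ` J \<subseteq> PiE Basis (\<lambda>_. {-int M..int M})"
    using M by (auto simp: k_def PiE_def Pi_def abs_le_iff) (smt (verit))+
  have "(\<Sum>j\<in>J. decay (y j)) \<le> (\<Sum>j\<in>J. A ^ DIM('a) * (\<Prod>b\<in>Basis. g (k j b)))"
  proof (rule sum_mono)
    fix j assume "j \<in> J"
    have "decay (y j) \<le> (\<Prod>b\<in>Basis. A * g (k j b))"
      unfolding decay_def using pt by (intro prod_mono) (auto simp: k_def)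
    then show "decay (y j) \<le> A ^ DIM('a) * (\<Prod>b\<in>Basis. g (k j b))"
      by (simp add: prod.distrib)
  qed
  also have "\<dots> = A ^ DIM('a) * (\<Sum>h\<in>k ` J. \<Prod>b\<in>Basis. g (h b))"
    by (simp add: sum_distrib_left sum.reindex[OF inj])
  also have "\<dots> \<le> A ^ DIM('a) * (\<Sum>h\<in>PiE (Basis::'a set) (\<lambda>_. {-int M..int M}). \<Prod>b\<in>Basis. g (h b))"
    using A by (intro mult_left_mono sum_mono2 sub finite_PiE prod_nonneg) (auto simp: g0)
  also have "\<dots> = A ^ DIM('a) * (\<Prod>b\<in>(Basis::'a set). \<Sum>m\<in>{-int M..int M}. g m)"
    by (subst prod_sum_PiE) auto
  also have "\<dots> \<le> A ^ DIM('a) * 5 ^ DIM('a)"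
  proof -
    have "(\<Sum>m\<in>{-int M..int M}. g m) \<le> 5"
      unfolding g_def by (rule sum_inverse_1_plus_square_le)
    then have "(\<Sum>m\<in>{-int M..int M}. g m) ^ DIM('a) \<le> 5 ^ DIM('a)"
      by (intro power_mono sum_nonneg g0)
    then show ?thesis using A by simp
  qed
  finally show ?thesis
    unfolding A_def s_def by (subst power_mult_distrib) (simp only: mult.commute)
qed

section \<open>Integrals of the decaying profile over the sphere\<close>

lemma nn_integral_inverse_1_plus_square_finite:
  "(\<integral>\<^sup>+x. ennreal (1 / (1 + x\<^sup>2)) \<partial>lborel) < \<infinity>"
proof -
  have "integrable lborel (\<lambda>x::real. 1 / (1 + x\<^sup>2))"
    using Sinc_Integral.integrable_inverse_1_plus_square
    by (simp add: set_integrable_def einterval_def inverse_eq_divide)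
  then show ?thesis
    by (simp add: integrable_iff_bounded)
qed

text \<open>
  The total mass of one factor of \<open>decay\<close>, which is \<open>pi\<close>.
\<close>

definition decay_mass :: "real" where
  "decay_mass = enn2real (\<integral>\<^sup>+x. ennreal (1 / (1 + x\<^sup>2)) \<partial>lborel)"

text \<open>
  The scaling behaviour \<open>n powr (- DIM('a))\<close> comes from the affine substitution in each coordinate.
\<close>

lemma nn_integral_decay:
  fixes a :: "'a::euclidean_space"
  assumes n: "n > 0"
  shows "(\<integral>\<^sup>+u. ennreal (decay (n *\<^sub>R (u - a))) \<partial>lborel) = ennreal ((decay_mass / n) ^ DIM('a))"
proof -
  define h where "h = (\<lambda>b x. ennreal (1 / (1 + (n * (x - inner a b))\<^sup>2)))"
  have mh: "h b \<in> borel_measurable borel" for b unfolding h_def by measurable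
  have 1: "(\<integral>\<^sup>+x. h b x \<partial>lborel) = ennreal (decay_mass / n)" for b :: 'a
  proof -
    have "(\<integral>\<^sup>+x. h b x \<partial>lborel) = ennreal \<bar>1/n\<bar> * (\<integral>\<^sup>+x. h b (inner a b + 1 / n * x) \<partial>lborel)"
      using n by (intro nn_integral_real_affine mh) auto
    also have "(\<lambda>x. h b (inner a b + 1 / n * x)) = (\<lambda>x. ennreal (1 / (1 + x\<^sup>2)))"
      using n by (simp add: h_def)
    also have "(\<integral>\<^sup>+x. ennreal (1 / (1 + x\<^sup>2)) \<partial>lborel) = ennreal decay_mass"
      using nn_integral_inverse_1_plus_square_finite by (simp add: decay_mass_def less_top)
    finally show ?thesis
      using n by (simp add: decay_mass_def flip: ennreal_mult)
  qed
  have "(\<integral>\<^sup>+u. ennreal (decay (n *\<^sub>R (u - a))) \<partial>lborel) = (\<integral>\<^sup>+u. (\<Prod>b\<in>Basis. h b (inner u b)) \<partial>lborel)"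
    unfolding decay_def h_def
    by (subst prod_ennreal) (auto simp: inner_diff_left)
  also have "\<dots> = (\<Prod>b\<in>(Basis::'a set). (\<integral>\<^sup>+x. h b x \<partial>lborel))"
    by (intro nn_integral_lborel_prod mh) simp
  also have "\<dots> = ennreal ((decay_mass / n) ^ DIM('a))"
    using n by (simp add: 1 ennreal_power decay_mass_def)
  finally show ?thesis .
qed

lemma measurable_sphere_measure: "f \<in> borel \<rightarrow>\<^sub>M N \<Longrightarrow> f \<in> sphere_measure \<rightarrow>\<^sub>M N"
  unfolding sphere_measure_def by (intro measurable_restrict_space1) simp

lemma space_sphere_measure: "space sphere_measure = sphere 0 1"
  by (simp add: sphere_measure_def space_restrict_space)

text \<open>
  The exponent \<open>DIM('a) - 1\<close> reflects the dimension of the sphere. The surface integral is an integral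
  over the unit ball of a function that is constant along rays. For a point \<open>u\<close> at radius \<open>t\<close> in
  direction \<open>x\<close>, the distance of \<open>u\<close> to one of the \<open>n\<close> centres \<open>(i / n) z\<close> on the segment from \<open>0\<close> to \<open>z\<close>
  exceeds the distance of \<open>x\<close> to \<open>z\<close> by at most \<open>1 / n\<close>. So the function is dominated by the sum of
  \<open>n\<close> translates of the scaled profile, each of which has an integral of order \<open>n powr (- DIM('a))\<close>.
\<close>

lemma sphere_decay_integral:
  fixes z :: "'a::euclidean_space"
  assumes z: "z \<in> sphere 0 1" and n: "n \<ge> (1::nat)"
  shows "(\<integral>\<^sup>+x. ennreal ((1 / (1 + (real n * dist x z)\<^sup>2)) ^ DIM('a)) \<partial>sphere_measure)
    \<le> ennreal (DIM('a) * 3 ^ DIM('a) * decay_mass ^ DIM('a) / real n ^ (DIM('a) - 1))"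
proof -
  define D where "D = DIM('a)"
  define f :: "'a \<Rightarrow> ennreal" where "f = (\<lambda>x. ennreal ((1 / (1 + (real n * dist x z)\<^sup>2)) ^ D))"
  have mf[measurable]: "f \<in> borel_measurable borel" unfolding f_def by measurable
  have [measurable]: "sphere (0::'a) 1 \<in> sets borel" by simp
  have [measurable]: "sgn \<in> restrict_space lborel (ball (0::'a) 1) \<rightarrow>\<^sub>M borel"
  proof (rule measurable_restrict_space1)
    show "sgn \<in> (lborel :: 'a measure) \<rightarrow>\<^sub>M borel" unfolding sgn_div_norm by measurable
  qed
  have "(\<integral>\<^sup>+x. f x \<partial>sphere_measure)
      = (\<integral>\<^sup>+x. f x * indicator (sphere 0 1) x \<partial>(scale_measure (of_nat D) (distr (restrict_space lborel (ball (0::'a) 1)) borel sgn)))"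
    unfolding sphere_measure_def D_def by (subst nn_integral_restrict_space) auto
  also have "\<dots> = of_nat D * (\<integral>\<^sup>+x. f x * indicator (sphere 0 1) x \<partial>(distr (restrict_space lborel (ball (0::'a) 1)) borel sgn))"
    by (subst nn_integral_scale_measure) (auto intro!: borel_measurable_times_ennreal borel_measurable_indicator mf)
  also have "\<dots> = of_nat D * (\<integral>\<^sup>+u. f (sgn u) * indicator (sphere 0 1) (sgn u) \<partial>(restrict_space lborel (ball (0::'a) 1)))"
    by (subst nn_integral_distr) auto
  also have "\<dots> = of_nat D * (\<integral>\<^sup>+u. f (sgn u) * indicator (sphere 0 1) (sgn u) * indicator (ball 0 1) u \<partial>lborel)"
    by (subst nn_integral_restrict_space) auto
  also have "\<dots> \<le> of_nat D * (\<integral>\<^sup>+u. (\<Sum>i<n. ennreal (3 ^ D) * ennreal (decay (real n *\<^sub>R (u - (real i / real n) *\<^sub>R z)))) \<partial>lborel)"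
  proof (intro mult_left_mono nn_integral_mono)
    fix u :: 'a
    show "f (sgn u) * indicator (sphere 0 1) (sgn u) * indicator (ball 0 1) u
      \<le> (\<Sum>i<n. ennreal (3 ^ D) * ennreal (decay (real n *\<^sub>R (u - (real i / real n) *\<^sub>R z))))"
    proof (cases "sgn u \<in> sphere 0 1 \<and> u \<in> ball 0 1")
      case True
      define t where "t = norm u"
      define x where "x = sgn u"
      have "u \<noteq> 0" using True by auto
      then have t: "0 \<le> t" "t < 1" and u: "u = t *\<^sub>R x"
        using True by (auto simp: t_def x_def sgn_div_norm)
      \<comment> \<open>the radius \<open>t\<close> rounded down to a multiple of \<open>1 / n\<close>\<close>
      define i where "i = nat \<lfloor>real n * t\<rfloor>"
      have i1: "real i \<le> real n * t" "real n * t < real i + 1"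
        using t by (auto simp: i_def)
      have "real n * t < real n" using t n by simp
      then have i: "i < n" using i1 by linarith
      define a where "a = (real i / real n) *\<^sub>R z"
      have "u - a = t *\<^sub>R (x - z) + (t - real i / real n) *\<^sub>R z"
        by (simp add: u a_def algebra_simps)
      then have "norm (u - a) \<le> t * norm (x - z) + \<bar>t - real i / real n\<bar>"
        using t z by (metis abs_of_nonneg mem_sphere_0 mult.right_neutral norm_scaleR norm_triangle_ineq)
      also have "\<dots> \<le> dist x z + 1 / real n"
      proof (intro add_mono)
        have "t - real i / real n = (real n * t - real i) / real n"
          using n by (simp add: field_simps)
        then show "\<bar>t - real i / real n\<bar> \<le> 1 / real n"
          using i1 by (auto simp: abs_divide intro!: divide_right_mono)
        show "t * norm (x - z) \<le> dist x z"
          using t by (simp add: dist_norm mult_left_le_one_le)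
      qed
      finally have "real n * norm (u - a) \<le> real n * dist x z + 1"
        using n by (simp add: field_simps)
      then have "(norm (real n *\<^sub>R (u - a)))\<^sup>2 \<le> (real n * dist x z + 1)\<^sup>2"
        by (intro power_mono) auto
      also have "\<dots> \<le> 2 * (real n * dist x z)\<^sup>2 + 2"
        using zero_le_power2[of "real n * dist x z - 1"]
        by (simp add: power2_eq_square algebra_simps)
      finally have X_le: "(norm (real n *\<^sub>R (u - a)))\<^sup>2 \<le> 2 * (real n * dist x z)\<^sup>2 + 2" .
      have le: "1 + (norm (real n *\<^sub>R (u - a)))\<^sup>2 \<le> 3 * (1 + (real n * dist x z)\<^sup>2)"
      proof -
        have "1 + X \<le> 3 * (1 + Y)" if "X \<le> 2 * Y + 2" "0 \<le> Y" for X Y :: real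
          using that by simp
        then show ?thesis using X_le zero_le_power2 by blast
      qed
      have "1 / (1 + (real n * dist x z)\<^sup>2) \<le> 3 * (1 / (1 + (norm (real n *\<^sub>R (u - a)))\<^sup>2))"
        using le by (simp add: divide_simps add_pos_nonneg del: norm_scaleR)
      then have "(1 / (1 + (real n * dist x z)\<^sup>2)) ^ D \<le> (3 * (1 / (1 + (norm (real n *\<^sub>R (u - a)))\<^sup>2))) ^ D"
        by (intro power_mono) auto
      also have "\<dots> = 3 ^ D * (1 / (1 + (norm (real n *\<^sub>R (u - a)))\<^sup>2)) ^ D"
        by (rule power_mult_distrib)
      also have "\<dots> \<le> 3 ^ D * decay (real n *\<^sub>R (u - a))"
        unfolding D_def by (intro mult_left_mono decay_ge) auto
      finally have "f x \<le> ennreal (3 ^ D) * ennreal (decay (real n *\<^sub>R (u - a)))"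
        unfolding f_def by (simp add: ennreal_leI flip: ennreal_mult' )
      also have "\<dots> \<le> (\<Sum>i<n. ennreal (3 ^ D) * ennreal (decay (real n *\<^sub>R (u - (real i / real n) *\<^sub>R z))))"
        unfolding a_def using i by (intro member_le_sum) auto
      finally show ?thesis using True by (simp add: x_def)
    qed auto
  qed auto
  also have "\<dots> = of_nat D * (\<Sum>i<n. ennreal (3 ^ D) * (\<integral>\<^sup>+u. ennreal (decay (real n *\<^sub>R (u - (real i / real n) *\<^sub>R z))) \<partial>lborel))"
    unfolding decay_def by (subst nn_integral_sum; (subst nn_integral_cmult)?) auto
  also have "\<dots> = ennreal (real D * (real n * (3 ^ D * (decay_mass / real n) ^ D)))"
    using n by (subst nn_integral_decay)
      (auto simp: D_def ennreal_of_nat_eq_real_of_nat decay_mass_def simp flip: ennreal_mult)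
  also have "real D * (real n * (3 ^ D * (decay_mass / real n) ^ D)) = real D * 3 ^ D * decay_mass ^ D / real n ^ (D - 1)"
  proof -
    have "real n ^ D = real n * real n ^ (D - 1)"
      unfolding D_def using DIM_positive[where 'a='a] by (metis Suc_diff_1 power_Suc)
    then show ?thesis using n by (simp add: power_divide)
  qed
  finally show ?thesis by (simp add: f_def D_def)
qed

section \<open>Counting separated points on the sphere\<close>

text \<open>
  The balls of radius \<open>h = \<delta> / 2\<close> about the points are disjoint and lie in the shell between the
  radii \<open>1 - h\<close> and \<open>1 + h\<close>, whose volume is \<open>O(h)\<close>. Comparing volumes gives a bound of order
  \<open>h powr (1 - DIM('a))\<close>.
\<close>

lemma card_separated_sphere:
  fixes y :: "'i \<Rightarrow> 'a::euclidean_space"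
  assumes "finite J" and \<delta>: "0 < \<delta>" "\<delta> \<le> 2"
    and S: "\<And>j. j \<in> J \<Longrightarrow> y j \<in> sphere 0 1"
    and sep: "\<And>i j. i \<in> J \<Longrightarrow> j \<in> J \<Longrightarrow> i \<noteq> j \<Longrightarrow> \<delta> \<le> dist (y i) (y j)"
  shows "real (card J) \<le> DIM('a) * 2 ^ DIM('a) * (2 / \<delta>) ^ (DIM('a) - 1)"
proof -
  define D where "D = DIM('a)"
  define h where "h = \<delta> / 2"
  have h: "0 < h" "h \<le> 1" using \<delta> by (auto simp: h_def)
  define v where "v = measure lborel (ball (0::'a) 1)"
  have v: "v > 0" unfolding v_def by (rule content_ball_pos) simp
  have cb: "measure lborel (ball c r) = r ^ D * v" if "r \<ge> 0" for c :: 'a and r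
    unfolding v_def D_def using that by (rule content_ball_conv_unit_ball)
  have disj: "disjoint_family_on (\<lambda>j. ball (y j) h) J"
    unfolding disjoint_family_on_def
  proof (intro ballI impI)
    fix i j assume ij: "i \<in> J" "j \<in> J" "i \<noteq> j"
    have "2 * h \<le> dist (y i) (y j)" using sep[OF ij] by (simp add: h_def)
    then show "ball (y i) h \<inter> ball (y j) h = {}"
      by (intro disjoint_ballI) simp
  qed
  have "real (card J) * (h ^ D * v) = (\<Sum>j\<in>J. measure lborel (ball (y j) h))"
    using h by (simp add: cb)
  also have "\<dots> = measure lborel (\<Union>j\<in>J. ball (y j) h)"
    using emeasure_lborel_ball_finite[where 'a='a]
    by (intro measure_finite_Union[symmetric] assms(1) disj) (auto simp: less_top)
  also have "\<dots> \<le> measure lborel (ball (0::'a) (1 + h) - ball 0 (1 - h))"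
  proof (rule measure_mono_fmeasurable)
    show "(\<Union>j\<in>J. ball (y j) h) \<subseteq> ball 0 (1 + h) - ball 0 (1 - h)"
    proof
      fix x assume "x \<in> (\<Union>j\<in>J. ball (y j) h)"
      then obtain j where j: "j \<in> J" "dist (y j) x < h" by auto
      have "norm (y j) = 1" using S[OF j(1)] by simp
      then show "x \<in> ball 0 (1 + h) - ball 0 (1 - h)"
        using j(2) norm_triangle_ineq2[of x "y j"] norm_triangle_ineq2[of "y j" x]
        by (auto simp: dist_norm norm_minus_commute)
    qed
    show "ball (0::'a) (1 + h) - ball 0 (1 - h) \<in> fmeasurable lborel"
      by (intro fmeasurable_Diff fmeasurableI emeasure_lborel_ball_finite) auto
    show "(\<Union>j\<in>J. ball (y j) h) \<in> sets lborel"
      using assms(1) by (intro sets.finite_UN) auto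
  qed
  also have "\<dots> = measure lborel (ball (0::'a) (1 + h)) - measure lborel (ball (0::'a) (1 - h))"
    using h emeasure_lborel_ball_finite[of "0::'a" "1 + h"] by (intro measure_Diff) auto
  also have "\<dots> = ((1 + h) ^ D - (1 - h) ^ D) * v"
    using h by (simp add: cb algebra_simps)
  also have "\<dots> \<le> (2 * h * (D * 2 ^ (D - 1))) * v"
  proof (intro mult_right_mono)
    have "(1 + h) ^ D - (1 - h) ^ D = ((1 + h) - (1 - h)) * (\<Sum>i<D. (1 - h) ^ (D - Suc i) * (1 + h) ^ i)"
      by (rule power_diff_sumr2)
    also have "\<dots> \<le> ((1 + h) - (1 - h)) * (\<Sum>i<D. 2 ^ (D - 1))"
    proof (intro mult_left_mono sum_mono)
      fix i assume "i \<in> {..<D}"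
      then have i: "i \<le> D - 1" by auto
      have "(1 - h) ^ (D - Suc i) * (1 + h) ^ i \<le> 1 ^ (D - Suc i) * (2::real) ^ i"
        using h by (intro mult_mono power_mono) auto
      also have "\<dots> \<le> 2 ^ (D - 1)" using i by (simp add: power_increasing)
      finally show "(1 - h) ^ (D - Suc i) * (1 + h) ^ i \<le> 2 ^ (D - 1)" .
    qed (use h in auto)
    finally show "(1 + h) ^ D - (1 - h) ^ D \<le> 2 * h * (D * 2 ^ (D - 1))" by simp
  qed (use v in auto)
  finally have "real (card J) * (h ^ D * v) \<le> (2 * h * (D * 2 ^ (D - 1))) * v" .
  then have "real (card J) * h ^ D \<le> 2 * h * (D * 2 ^ (D - 1))"
    using v by simp
  moreover obtain d where d: "D = Suc d"
    using DIM_positive[where 'a='a] by (metis D_def Suc_pred)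
  ultimately have "h * (real (card J) * h ^ d) \<le> h * (D * 2 ^ D)"
    by (simp add: algebra_simps)
  then have "real (card J) * h ^ d \<le> D * 2 ^ D" using h by simp
  then have "real (card J) \<le> D * 2 ^ D / h ^ d" using h by (simp add: pos_le_divide_eq)
  also have "\<dots> = D * 2 ^ D * (2 / \<delta>) ^ (D - 1)"
    using \<delta> by (simp add: h_def d power_divide)
  finally show ?thesis by (simp add: D_def)
qed

section \<open>Localized zonal polynomials\<close>

text \<open>
  These are the Chebyshev polynomials of the first kind, obtained from their three-term recursion.
\<close>

lemma chebyshev_exists:
  "\<exists>p::real poly. degree p \<le> k \<and> (\<forall>\<theta>. poly p (cos \<theta>) = cos (real k * \<theta>))"
proof -
  \<comment> \<open>The recursion has depth two, so two consecutive polynomials are carried along.\<close>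
  have "(\<exists>p::real poly. degree p \<le> k \<and> (\<forall>\<theta>. poly p (cos \<theta>) = cos (real k * \<theta>))) \<and>
        (\<exists>p::real poly. degree p \<le> Suc k \<and> (\<forall>\<theta>. poly p (cos \<theta>) = cos (real (Suc k) * \<theta>)))"
  proof (induction k)
    case 0
    show ?case
      by (intro conjI exI[of _ 1] exI[of _ "[:0, 1:]"]) auto
  next
    case (Suc k)
    then obtain p q :: "real poly"
      where p: "degree p \<le> k" "\<And>\<theta>. poly p (cos \<theta>) = cos (real k * \<theta>)"
        and q: "degree q \<le> Suc k" "\<And>\<theta>. poly q (cos \<theta>) = cos (real (Suc k) * \<theta>)"
      by blast
    define r where "r = [:0, 2:] * q - p"
    have "degree r \<le> Suc (Suc k)"
      unfolding r_def using p(1) q(1)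
      by (intro degree_diff_le order.trans[OF degree_mult_le]) auto
    moreover have "poly r (cos \<theta>) = cos (real (Suc (Suc k)) * \<theta>)" for \<theta>
    proof -
      have "cos (real (Suc k) * \<theta> + \<theta>) + cos (real (Suc k) * \<theta> - \<theta>) = 2 * cos \<theta> * cos (real (Suc k) * \<theta>)"
        by (simp add: cos_add cos_diff)
      moreover have "real (Suc k) * \<theta> + \<theta> = real (Suc (Suc k)) * \<theta>" "real (Suc k) * \<theta> - \<theta> = real k * \<theta>"
        by (auto simp: algebra_simps)
      ultimately show ?thesis by (simp add: r_def p(2) q(2))
    qed
    ultimately show ?case using q by blast
  qed
  then show ?thesis by blast
qed

text \<open>
  The polynomial is the normalized Fejer kernel in the variable \<open>t = cos \<theta>\<close>: with \<open>w = cis \<theta>\<close> it equals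
  the square of \<open>\<bar>1 + w + \<dots> + w ^ (n - 1)\<bar> / n\<close>. Positivity and the bound by \<open>1\<close> are visible from this
  formula. The decay follows by multiplying the geometric sum by \<open>1 - w\<close>, because
  \<open>\<bar>1 - w ^ n\<bar> \<le> 2\<close> and \<open>\<bar>1 - w\<bar>\<^sup>2 = 2 - 2 t\<close>.
\<close>

lemma fejer_kernel_exists:
  assumes n: "n \<ge> (1::nat)"
  shows "\<exists>p::real poly. degree p < n \<and> poly p 1 = 1 \<and>
    (\<forall>t\<in>{-1..1}. 0 \<le> poly p t \<and> poly p t \<le> 1 \<and> poly p t * ((real n)\<^sup>2 * (2 - 2 * t)) \<le> 4)"
proof -
  obtain T :: "nat \<Rightarrow> real poly" where T: "\<And>k. degree (T k) \<le> k" 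
      "\<And>k \<theta>. poly (T k) (cos \<theta>) = cos (real k * \<theta>)"
    using chebyshev_exists by metis
  \<comment> \<open>expansion of the squared modulus of the geometric sum into cosines of multiples of \<open>\<theta>\<close>\<close>
  define p where "p = Polynomial.smult (1 / (real n)\<^sup>2) (\<Sum>j<n. \<Sum>k<n. T (nat \<bar>int j - int k\<bar>))"
  have deg: "degree p < n"
  proof -
    have "degree p \<le> n - 1"
      unfolding p_def
      by (intro order.trans[OF degree_smult_le] degree_sum_le) (auto intro!: order.trans[OF T(1)])
    then show ?thesis using n by linarith
  qed
  have val: "poly p (cos \<theta>) = (cmod (\<Sum>j<n. cis \<theta> ^ j))\<^sup>2 / (real n)\<^sup>2" for \<theta>
  proof -
    have "complex_of_real ((cmod (\<Sum>j<n. cis \<theta> ^ j))\<^sup>2) = (\<Sum>j<n. cis \<theta> ^ j) * cnj (\<Sum>j<n. cis \<theta> ^ j)"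
      by (simp only: complex_norm_square)
    also have "\<dots> = (\<Sum>j<n. \<Sum>k<n. cis ((real j - real k) * \<theta>))"
      by (simp add: sum_product Complex.DeMoivre cis_cnj cis_mult algebra_simps)
    finally have "(cmod (\<Sum>j<n. cis \<theta> ^ j))\<^sup>2 = (\<Sum>j<n. \<Sum>k<n. cos ((real j - real k) * \<theta>))"
      by (simp add: complex_eq_iff)
    also have "\<dots> = (\<Sum>j<n. \<Sum>k<n. poly (T (nat \<bar>int j - int k\<bar>)) (cos \<theta>))"
    proof (intro sum.cong refl)
      fix j k
      have "real (nat \<bar>int j - int k\<bar>) = \<bar>real j - real k\<bar>" by auto
      then show "cos ((real j - real k) * \<theta>) = poly (T (nat \<bar>int j - int k\<bar>)) (cos \<theta>)"
        unfolding T(2) by (metis abs_if cos_minus minus_mult_left)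
    qed
    also have "\<dots> = (real n)\<^sup>2 * poly p (cos \<theta>)"
      using n by (simp add: p_def poly_sum)
    finally show ?thesis using n by (simp add: field_simps)
  qed
  have "poly p 1 = 1" using val[of 0] n by simp
  moreover have "0 \<le> poly p t \<and> poly p t \<le> 1 \<and> poly p t * ((real n)\<^sup>2 * (2 - 2 * t)) \<le> 4"
    if t: "t \<in> {-1..1}" for t
  proof -
    define \<theta> where "\<theta> = arccos t"
    have th: "t = cos \<theta>" using t by (simp add: \<theta>_def)
    define w where "w = cis \<theta>"
    have "cmod (\<Sum>j<n. w ^ j) \<le> (\<Sum>j<n. cmod (w ^ j))" by (rule norm_sum)
    also have "\<dots> = real n" by (simp add: w_def norm_power)
    finally have "(cmod (\<Sum>j<n. w ^ j))\<^sup>2 \<le> (real n)\<^sup>2" by (intro power_mono) auto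
    then have b1: "poly p t \<le> 1" using n unfolding th val w_def by simp
    have "(1 - w) * (\<Sum>j<n. w ^ j) = 1 - w ^ n"
      by (simp add: one_diff_power_eq)
    then have "cmod (1 - w) * cmod (\<Sum>j<n. w ^ j) = cmod (1 - w ^ n)"
      by (metis norm_mult)
    also have "\<dots> \<le> 2"
      using norm_triangle_ineq4[of 1 "w ^ n"] by (simp add: w_def norm_power)
    finally have "(cmod (1 - w) * cmod (\<Sum>j<n. w ^ j))\<^sup>2 \<le> 2\<^sup>2" by (intro power_mono) auto
    moreover have "(cmod (1 - w))\<^sup>2 = 2 - 2 * t"
      unfolding cmod_power2 using sin_cos_squared_add[of \<theta>]
      by (simp add: w_def th power2_eq_square algebra_simps)
    ultimately have "(2 - 2 * t) * (cmod (\<Sum>j<n. w ^ j))\<^sup>2 \<le> 4" by (simp add: power_mult_distrib)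
    then have b2: "poly p t * ((real n)\<^sup>2 * (2 - 2 * t)) \<le> 4"
      using n unfolding th val w_def by (simp add: mult.commute)
    have "0 \<le> poly p t" unfolding th val by simp
    with b1 b2 show ?thesis by simp
  qed
  ultimately show ?thesis using deg by blast
qed

text \<open>
  For unit vectors, \<open>2 - 2 (x \<bullet> z)\<close> is the square of the distance, so the Fejer kernel as a zonal
  function decays quadratically in \<open>n\<close> times the distance.
\<close>

lemma localizing_kernel:
  fixes n :: nat
  assumes n: "n \<ge> 1"
  obtains p :: "real poly" where "degree p < n" "poly p 1 = 1"
    "\<And>x z :: 'a::euclidean_space. x \<in> sphere 0 1 \<Longrightarrow> z \<in> sphere 0 1 \<Longrightarrow>
       0 \<le> poly p (inner x z) \<and> poly p (inner x z) \<le> 5 * (1 / (1 + (real n * dist x z)\<^sup>2))"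
proof -
  obtain p :: "real poly" where p: "degree p < n" "poly p 1 = 1"
    "\<And>t. t \<in> {-1..1} \<Longrightarrow> 0 \<le> poly p t \<and> poly p t \<le> 1 \<and> poly p t * ((real n)\<^sup>2 * (2 - 2 * t)) \<le> 4"
    using fejer_kernel_exists[OF n] by blast
  have "0 \<le> poly p (inner x z) \<and> poly p (inner x z) \<le> 5 * (1 / (1 + (real n * dist x z)\<^sup>2))"
    if x: "x \<in> sphere 0 1" and z: "z \<in> sphere 0 1" for x z :: 'a
  proof -
    have nx: "norm x = 1" "inner x x = 1" and nz: "norm z = 1" "inner z z = 1"
      using x z by (auto simp: norm_eq_1)
    have t: "inner x z \<in> {-1..1}" using Cauchy_Schwarz_ineq2[of x z] nx nz by (auto simp: abs_le_iff)
    have "(dist x z)\<^sup>2 = 2 - 2 * inner x z"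
      unfolding dist_norm power2_norm_eq_inner
      by (simp add: inner_diff_left inner_diff_right nx nz inner_commute[of z x])
    then have "poly p (inner x z) * (real n * dist x z)\<^sup>2 \<le> 4"
      using p(3)[OF t] by (simp add: power_mult_distrib)
    then have "poly p (inner x z) * (1 + (real n * dist x z)\<^sup>2) \<le> 5"
      using p(3)[OF t] by (simp add: distrib_left)
    then show ?thesis using p(3)[OF t] by (simp add: pos_le_divide_eq add_pos_nonneg)
  qed
  then show ?thesis using that[of p] p(1,2) by blast
qed

section \<open>Polynomial functions\<close>

lemma poly_funs_zero: "(\<lambda>x. 0) \<in> poly_funs L"
  using cfun.span_zero unfolding poly_funs_def zero_fun_def by blast

lemma poly_funs_add: "f \<in> poly_funs L \<Longrightarrow> g \<in> poly_funs L \<Longrightarrow> (\<lambda>x. f x + g x) \<in> poly_funs L"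
  using cfun.span_add unfolding poly_funs_def plus_fun_def by blast

lemma poly_funs_cmult: "f \<in> poly_funs L \<Longrightarrow> (\<lambda>x. c * f x) \<in> poly_funs L"
  using cfun.span_scale unfolding poly_funs_def scale_fun_def by blast

lemma poly_funs_monomial: "(\<Sum>b\<in>Basis. \<alpha> b) \<le> L \<Longrightarrow> monomial_fun \<alpha> \<in> poly_funs L"
  unfolding poly_funs_def by (intro cfun.span_base) auto

lemma poly_funs_sum:
  "(\<And>i. i \<in> I \<Longrightarrow> f i \<in> poly_funs L) \<Longrightarrow> (\<lambda>x. \<Sum>i\<in>I. f i x) \<in> poly_funs L"
  by (induction I rule: infinite_finite_induct) (auto intro: poly_funs_zero poly_funs_add)

text \<open>
  Reduces a property that is compatible with the pointwise vector space operations to monomials.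
\<close>

lemma poly_funs_induct [consumes 1, case_names zero add cmult monomial]:
  assumes f: "f \<in> poly_funs L"
    and zero: "P (\<lambda>x. 0)"
    and add: "\<And>f g. P f \<Longrightarrow> P g \<Longrightarrow> P (\<lambda>x. f x + g x)"
    and cmult: "\<And>c f. P f \<Longrightarrow> P (\<lambda>x. c * f x)"
    and monomial: "\<And>\<alpha>. (\<Sum>b\<in>Basis. \<alpha> b) \<le> L \<Longrightarrow> P (monomial_fun \<alpha>)"
  shows "P f"
  using f unfolding poly_funs_def
proof (rule cfun.span_induct)
  show "cfun.subspace (Collect P)"
    by (rule cfun.subspaceI) (auto simp: zero_fun_def plus_fun_def scale_fun_def zero intro: add cmult)
qed (auto intro: monomial)

lemma poly_funs_mono: "L \<le> L' \<Longrightarrow> f \<in> poly_funs L \<Longrightarrow> f \<in> poly_funs L'"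
  by (erule poly_funs_induct)
     (auto intro: poly_funs_zero poly_funs_add poly_funs_cmult poly_funs_monomial)

lemma monomial_fun_mult: "monomial_fun \<alpha> x * monomial_fun \<beta> x = monomial_fun (\<lambda>b. \<alpha> b + \<beta> b) x"
  by (simp add: monomial_fun_def power_add prod.distrib)

lemma poly_funs_mult:
  assumes "f \<in> poly_funs k" "g \<in> poly_funs l"
  shows "(\<lambda>x. f x * g x) \<in> poly_funs (k + l)"
  using assms(1)
proof (induction rule: poly_funs_induct)
  case (monomial \<alpha>)
  show ?case using assms(2)
  proof (induction rule: poly_funs_induct)
    case (monomial \<beta>)
    show ?case unfolding monomial_fun_mult
      by (rule poly_funs_monomial) (use monomial \<open>sum \<alpha> Basis \<le> k\<close> in \<open>simp add: sum.distrib\<close>)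
  next
    case (cmult c f)
    then have "(\<lambda>x. c * (monomial_fun \<alpha> x * f x)) \<in> poly_funs (k + l)" by (rule poly_funs_cmult)
    then show ?case by (simp add: mult.left_commute)
  qed (auto simp: ring_distribs intro: poly_funs_zero poly_funs_add)
qed (auto simp: ring_distribs mult.assoc intro: poly_funs_zero poly_funs_add poly_funs_cmult)

lemma poly_funs_const: "(\<lambda>x. c) \<in> poly_funs L"
proof -
  have "monomial_fun (\<lambda>_. 0) = (\<lambda>x::'a. 1)" by (simp add: monomial_fun_def)
  then have "(\<lambda>x::'a. 1) \<in> poly_funs L" using poly_funs_monomial[of "\<lambda>_::'a. 0" L] by simp
  from poly_funs_cmult[OF this, of c] show ?thesis by simp
qed

lemma poly_funs_power:
  assumes "f \<in> poly_funs k"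
  shows "(\<lambda>x. f x ^ m) \<in> poly_funs (m * k)"
proof (induction m)
  case (Suc m)
  from poly_funs_mult[OF assms Suc] show ?case by simp
qed (simp add: poly_funs_const)

lemma poly_funs_coordinate:
  assumes "b \<in> Basis"
  shows "(\<lambda>x. complex_of_real (inner x b)) \<in> poly_funs 1"
proof -
  have "monomial_fun (\<lambda>b'. if b' = b then 1 else 0) = (\<lambda>x. complex_of_real (inner x b))"
    using assms by (simp add: monomial_fun_def if_distrib[of "power _"] prod.delta cong: if_cong)
  moreover have "monomial_fun (\<lambda>b'. if b' = b then 1 else 0) \<in> poly_funs 1"
    by (rule poly_funs_monomial) (use assms in \<open>simp add: sum.delta\<close>)
  ultimately show ?thesis by simp
qed

lemma poly_funs_inner: "(\<lambda>x. complex_of_real (inner x z)) \<in> poly_funs 1"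
proof -
  have "(\<lambda>x. \<Sum>b\<in>Basis. complex_of_real (inner z b) * complex_of_real (inner x b)) \<in> poly_funs 1"
    by (intro poly_funs_sum poly_funs_cmult poly_funs_coordinate)
  then show ?thesis
    by (subst euclidean_inner) (simp add: mult.commute)
qed

lemma poly_funs_zonal:
  assumes "degree p \<le> k"
  shows "(\<lambda>x. complex_of_real (poly p (inner x z))) \<in> poly_funs k"
proof -
  have "(\<lambda>x. \<Sum>i\<le>degree p. complex_of_real (coeff p i) * complex_of_real (inner x z) ^ i) \<in> poly_funs k"
  proof (intro poly_funs_sum poly_funs_cmult)
    fix i assume "i \<in> {..degree p}"
    then have "i * 1 \<le> k" using assms by simp
    then show "(\<lambda>x. complex_of_real (inner x z) ^ i) \<in> poly_funs k"
      by (rule poly_funs_mono[OF _ poly_funs_power[OF poly_funs_inner]])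
  qed
  then show ?thesis by (simp add: poly_altdef)
qed

lemma poly_funs_continuous: "f \<in> poly_funs L \<Longrightarrow> continuous_on UNIV f"
  by (induction rule: poly_funs_induct)
     (auto simp: monomial_fun_def[abs_def] intro!: continuous_intros)

section \<open>Polynomials on the sphere and their dimension\<close>

lemma sphere_polysE:
  assumes "f \<in> sphere_polys L"
  obtains g where "g \<in> poly_funs L" "\<And>x. x \<in> sphere 0 1 \<Longrightarrow> f x = g x" "\<And>x. x \<notin> sphere 0 1 \<Longrightarrow> f x = 0"
  using assms unfolding sphere_polys_def sphere_restrict_def by auto

lemma sphere_polysI:
  assumes "g \<in> poly_funs L" "\<And>x. x \<in> sphere 0 1 \<Longrightarrow> f x = g x" "\<And>x. x \<notin> sphere 0 1 \<Longrightarrow> f x = 0"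
  shows "f \<in> sphere_polys L"
  unfolding sphere_polys_def sphere_restrict_def 
  by (rule image_eqI[OF _ assms(1)]) (use assms in \<open>auto simp: fun_eq_iff\<close>)

lemma sphere_polys_mult:
  assumes "f \<in> sphere_polys k" "g \<in> poly_funs l"
  shows "(\<lambda>x. g x * f x) \<in> sphere_polys (l + k)"
proof -
  obtain h where "h \<in> poly_funs k" "\<And>x. x \<in> sphere 0 1 \<Longrightarrow> f x = h x" "\<And>x. x \<notin> sphere 0 1 \<Longrightarrow> f x = 0"
    using sphere_polysE[OF assms(1)] by metis
  then show ?thesis by (intro sphere_polysI[OF poly_funs_mult[OF assms(2)]]) auto
qed

lemma sphere_polys_mono: "k \<le> l \<Longrightarrow> sphere_polys k \<subseteq> sphere_polys l"
  unfolding sphere_polys_def using poly_funs_mono by blast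

lemma sphere_polys_lincomb:
  assumes "\<And>i. i \<in> I \<Longrightarrow> f i \<in> sphere_polys L"
  shows "(\<lambda>x. \<Sum>i\<in>I. c i * f i x) \<in> sphere_polys L"
proof -
  have "\<exists>g. \<forall>i\<in>I. g i \<in> poly_funs L \<and> f i = sphere_restrict (g i)"
    using assms unfolding sphere_polys_def by (intro bchoice) auto
  then obtain g where g: "\<And>i. i \<in> I \<Longrightarrow> g i \<in> poly_funs L" "\<And>i. i \<in> I \<Longrightarrow> f i = sphere_restrict (g i)"
    by blast
  show ?thesis
    by (rule sphere_polysI[of "\<lambda>x. \<Sum>i\<in>I. c i * g i x"])
       (auto simp: g sphere_restrict_def intro!: poly_funs_sum poly_funs_cmult)
qed

lemma sphere_polys_measurable:
  assumes "f \<in> sphere_polys L"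
  shows "f \<in> borel_measurable sphere_measure"
proof -
  obtain g where g: "g \<in> poly_funs L" "f = sphere_restrict g" using assms by (auto simp: sphere_polys_def)
  have [measurable]: "g \<in> borel_measurable borel"
    by (rule borel_measurable_continuous_onI[OF poly_funs_continuous[OF g(1)]])
  have [measurable]: "sphere (0::'a) 1 \<in> sets borel" by simp
  have "f \<in> borel_measurable borel" unfolding g sphere_restrict_def by measurable
  then show ?thesis by (rule measurable_sphere_measure)
qed

lemma sum_fun_apply: "(\<Sum>v\<in>A. h v) x = (\<Sum>v\<in>A. h v x)"
  by (induction A rule: infinite_finite_induct) auto

text \<open>
  A linear relation between the values on the sphere extends to the whole space, since the functions
  of \<open>sphere_polys\<close> vanish off the sphere.
\<close>

lemma sphere_basis_independent:
  fixes Q :: "nat \<Rightarrow> 'a::euclidean_space \<Rightarrow> complex"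
  assumes Q: "sphere_basis L Q" and zero: "\<And>x. x \<in> sphere 0 1 \<Longrightarrow> (\<Sum>i<sphere_dim TYPE('a) L. a i * Q i x) = 0"
    and i: "i < sphere_dim TYPE('a) L"
  shows "a i = 0"
proof -
  define N where "N = sphere_dim TYPE('a) L"
  have inj: "inj_on Q {..<N}" and ind: "cfun.independent (Q ` {..<N})" and sp: "cfun.span (Q ` {..<N}) = sphere_polys L"
    using Q unfolding sphere_basis_def N_def by auto
  have mem: "Q i \<in> sphere_polys L" if "i < N" for i
    using that unfolding sp[symmetric] by (intro cfun.span_base) auto
  have 0: "(\<Sum>i<N. a i * Q i x) = 0" for x
  proof (cases "x \<in> sphere 0 1")
    case True
    then show ?thesis using zero by (simp add: N_def)
  next
    case False
    then have "Q i x = 0" if "i < N" for i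
      using sphere_polysE[OF mem[OF that]] by metis
    then show ?thesis by simp
  qed
  define u where "u = (\<lambda>v. a (the_inv_into {..<N} Q v))"
  have u: "u (Q i) = a i" if "i < N" for i
    using that inj by (simp add: u_def the_inv_into_f_f)
  have "(\<Sum>v\<in>Q ` {..<N}. scale_fun (u v) v) = 0"
  proof
    fix x
    show "(\<Sum>v\<in>Q ` {..<N}. scale_fun (u v) v) x = 0 x"
      using 0[of x] unfolding sum_fun_apply by (simp add: scale_fun_def sum.reindex[OF inj] u)
  qed
  with ind have "u (Q i) = 0"
    using i unfolding N_def[symmetric] by (subst (asm) cfun.dependent_finite) auto
  with u i show ?thesis by (simp add: N_def)
qed

lemma sphere_dim_le:
  fixes Q :: "nat \<Rightarrow> 'a::euclidean_space \<Rightarrow> complex"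
  assumes Q: "sphere_basis L Q" and "V \<subseteq> (sphere_polys L :: ('a \<Rightarrow> complex) set)"
  shows "cfun.dim V \<le> sphere_dim TYPE('a) L"
proof -
  have "V \<subseteq> cfun.span (Q ` {..<sphere_dim TYPE('a) L})" using assms by (simp add: sphere_basis_def)
  then have "cfun.dim V \<le> card (Q ` {..<sphere_dim TYPE('a) L})" by (rule cfun.dim_le_card) simp
  also have "\<dots> \<le> sphere_dim TYPE('a) L" using card_image_le[of "{..<sphere_dim TYPE('a) L}" Q] by simp
  finally show ?thesis .
qed

text \<open>
  In dimension at least two, a coordinate takes all values in \<open>[-1, 1]\<close> on the sphere, so its powers
  of exponent \<open>0, \<dots>, L\<close> are linearly independent there.
\<close>

lemma sphere_dim_gt:
  fixes Q :: "nat \<Rightarrow> 'a::euclidean_space \<Rightarrow> complex"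
  assumes Q: "sphere_basis L Q" and dim: "DIM('a) \<ge> 2"
  shows "L < sphere_dim TYPE('a) L"
proof -
  obtain b :: 'a where b1: "b \<in> Basis" using nonempty_Basis by blast
  have "\<exists>b'\<in>Basis. b' \<noteq> b"
  proof (rule ccontr)
    assume "\<not> (\<exists>b'\<in>Basis. b' \<noteq> b)"
    then have "(Basis :: 'a set) \<subseteq> {b}" by blast
    then have "DIM('a) \<le> card {b}" by (intro card_mono) auto
    then show False using dim by simp
  qed
  then obtain b' where b: "b \<in> Basis" "b' \<in> Basis" "b \<noteq> b'" using b1 by blast
  \<comment> \<open>a half circle along which the coordinate \<open>inner x b\<close> runs through \<open>[-1, 1]\<close>\<close>
  define pt where "pt = (\<lambda>t. t *\<^sub>R b + sqrt (1 - t\<^sup>2) *\<^sub>R b')"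
  have pt: "pt t \<in> sphere 0 1" "inner (pt t) b = t" if "t \<in> {-1..1}" for t
  proof -
    have "t\<^sup>2 \<le> 1" using that by (simp add: abs_square_le_1 abs_le_iff)
    then have "inner (pt t) (pt t) = 1"
      using b by (simp add: pt_def inner_add_left inner_add_right inner_Basis power2_eq_square)
    then show "pt t \<in> sphere 0 1" by (simp add: norm_eq_1)
    show "inner (pt t) b = t" using b by (simp add: pt_def inner_add_left inner_Basis)
  qed
  define F :: "nat \<Rightarrow> 'a \<Rightarrow> complex" where "F = (\<lambda>k. sphere_restrict (\<lambda>x. complex_of_real (inner x b) ^ k))"
  have F: "F k (pt t) = of_real t ^ k" if "t \<in> {-1..1}" for k t
    using pt[OF that] by (simp add: F_def sphere_restrict_def)
  have inj: "inj_on F {..L}"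
  proof (rule inj_onI)
    fix i j assume "F i = F j"
    moreover have "F i (pt (1/2)) = of_real ((1/2) ^ i)" "F j (pt (1/2)) = of_real ((1/2) ^ j)"
      unfolding of_real_power by (rule F, simp)+
    ultimately have "(1/2::real) ^ i = (1/2) ^ j" by (metis of_real_eq_iff)
    then show "i = j" by (simp add: power_one_over)
  qed
  have ind: "cfun.independent (F ` {..L})"
  proof
    assume "cfun.dependent (F ` {..L})"
    then obtain u k where u: "(\<Sum>v\<in>F ` {..L}. scale_fun (u v) v) = 0" and k: "k \<le> L" "u (F k) \<noteq> 0"
      by (subst (asm) cfun.dependent_finite) auto
    define q where "q = (\<Sum>k\<le>L. monom (u (F k)) k)"
    have "poly q (of_real t) = 0" if "t \<in> {-1..1}" for t
    proof -
      have "(\<Sum>v\<in>F ` {..L}. scale_fun (u v) v) (pt t) = 0" using u by simp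
      then show ?thesis
        unfolding sum_fun_apply by (simp add: sum.reindex[OF inj] scale_fun_def F[OF that] q_def poly_sum poly_monom)
    qed
    then have "of_real ` {-1..1::real} \<subseteq> {x. poly q x = 0}" by auto
    moreover have "infinite (complex_of_real ` {-1..1})"
      by (subst finite_image_iff) (auto simp: inj_on_def)
    ultimately have "q = 0" using poly_roots_finite finite_subset by blast
    then have "coeff q k = 0" by simp
    then show False using k by (simp add: q_def coeff_sum)
  qed
  have "F ` {..L} \<subseteq> sphere_polys L"
  proof
    fix f assume "f \<in> F ` {..L}"
    then obtain k where k: "k \<le> L" "f = F k" by auto
    have "(\<lambda>x. complex_of_real (inner x b) ^ k) \<in> poly_funs (k * 1)"
      by (intro poly_funs_power poly_funs_inner)
    then show "f \<in> sphere_polys L"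
      using k poly_funs_mono[of "k * 1" L] by (auto simp: sphere_polys_def F_def)
  qed
  also have "\<dots> = cfun.span (Q ` {..<sphere_dim TYPE('a) L})" using Q by (simp add: sphere_basis_def)
  finally have "card (F ` {..L}) \<le> card (Q ` {..<sphere_dim TYPE('a) L})"
    using cfun.independent_span_bound[OF _ ind] by blast
  also have "\<dots> \<le> sphere_dim TYPE('a) L" using card_image_le[of "{..<sphere_dim TYPE('a) L}" Q] by simp
  finally show ?thesis using card_image[OF inj] by simp
qed

section \<open>Zeros of a polynomial stay away from its maxima on the sphere\<close>

text \<open>
  A weak form of Bernstein's inequality. The maximum principle for \<open>p\<close> and for its reversed polynomial
  gives \<open>\<bar>p u\<bar> \<le> (max 1 \<bar>u\<bar>) ^ n\<close>, so \<open>\<bar>p\<bar> \<le> (1 + 1 / n) ^ n < 3\<close> on the disc of radius \<open>1 / n\<close> about the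
  zero \<open>w\<close>. By the Schwarz lemma on this disc, \<open>\<bar>p v\<bar> \<le> 3 n \<bar>v - w\<bar>\<close>.
\<close>

lemma dist_zero_from_unit_circle_max:
  fixes p :: "complex poly"
  assumes deg: "degree p \<le> n" and n: "n \<ge> 1"
    and bd: "\<And>u. norm u = 1 \<Longrightarrow> norm (poly p u) \<le> 1"
    and w: "norm w = 1" "poly p w = 0"
    and v: "norm v = 1" "norm (poly p v) = 1"
  shows "1 \<le> 3 * real n * dist v w"
proof -
  have in_disc: "norm (poly q u) \<le> 1" 
    if q: "\<And>u. norm u = 1 \<Longrightarrow> norm (poly q u) \<le> 1" and u: "norm u \<le> 1" for q :: "complex poly" and u
  proof (rule maximum_modulus_frontier[where S = "cball 0 1" and f = "poly q"])
    show "poly q holomorphic_on interior (cball 0 1)"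
      by (intro holomorphic_intros)
    show "continuous_on (closure (cball 0 1)) (poly q)"
      by (intro continuous_intros)
  qed (use u q in auto)
  have growth: "norm (poly p u) \<le> (max 1 (norm u)) ^ n" for u
  proof (cases "norm u \<le> 1")
    case True
    then show ?thesis using in_disc[OF bd] by (auto simp: max_def)
  next
    case False
    \<comment> \<open>\<open>q x = x ^ n * p (1 / x)\<close> exchanges the inside and the outside of the unit disc.\<close>
    define q where "q = monom 1 (n - degree p) * reflect_poly p"
    have q: "poly q x = x ^ n * poly p (1 / x)" if "x \<noteq> 0" for x
      using that deg by (simp add: q_def poly_monom poly_reflect_poly_nz inverse_eq_divide flip: power_add mult.assoc)
    have "norm (poly q (1 / u)) \<le> 1"
    proof (rule in_disc)
      fix x :: complex assume x: "norm x = 1"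
      then have "x \<noteq> 0" by auto
      then show "norm (poly q x) \<le> 1"
        using bd[of "1 / x"] x by (simp add: q norm_mult norm_power norm_divide)
    qed (use False in \<open>simp add: norm_divide divide_le_eq\<close>)
    moreover have "u \<noteq> 0" using False by auto
    ultimately have "norm (poly p u) \<le> norm u ^ n"
      using False by (simp add: q norm_mult norm_power norm_divide field_simps)
    then show ?thesis using False by (simp add: max_def)
  qed
  define g where "g = (\<lambda>s. poly p (w + s / of_nat n) / 3)"
  have g: "norm (g s) < 1" if s: "norm s < 1" for s
  proof -
    have "norm (w + s / of_nat n) \<le> norm w + norm (s / of_nat n)" by (rule norm_triangle_ineq)
    also have "\<dots> \<le> 1 + 1 / real n"
      using w s n by (simp add: norm_divide divide_right_mono)
    finally have "norm (poly p (w + s / of_nat n)) \<le> (1 + 1 / real n) ^ n"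
      by (intro order.trans[OF growth] power_mono) auto
    also have "\<dots> \<le> exp 1" using exp_ge_one_plus_x_over_n_power_n[of n 1] n by simp
    also have "\<dots> < 3" using e_less_272 by simp
    finally show ?thesis by (simp add: g_def norm_divide)
  qed
  show ?thesis
  proof (cases "real n * dist v w < 1")
    case True
    define s where "s = of_nat n * (v - w)"
    have s: "norm s < 1" using True by (simp add: s_def norm_mult dist_norm)
    have "norm (g s) \<le> norm s"
    proof (rule Schwarz_Lemma(1)[of g])
      show "g holomorphic_on ball 0 1"
        unfolding g_def using n by (intro holomorphic_intros) auto
      show "g 0 = 0" using w by (simp add: g_def)
    qed (use g s in auto)
    moreover have "norm (g s) = 1 / 3" using v n by (simp add: g_def s_def norm_divide)
    ultimately show ?thesis by (simp add: s_def norm_mult dist_norm)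
  next
    case False
    then show ?thesis by simp
  qed
qed

text \<open>
  On the circle, \<open>cis \<theta>\<close> times a coordinate of the moving point is a quadratic polynomial in \<open>cis \<theta>\<close>.
  A monomial of degree \<open>m\<close> thus becomes a polynomial of degree \<open>2 m\<close> after multiplication by
  \<open>cis \<theta> ^ m\<close>, and the remaining factor \<open>cis \<theta> ^ (L - m)\<close> makes the twist uniform.
\<close>

lemma poly_funs_great_circle:
  fixes x e :: "'a::euclidean_space"
  assumes "f \<in> poly_funs L"
  shows "\<exists>p. degree p \<le> 2 * L \<and>
    (\<forall>\<theta>. poly p (cis \<theta>) = cis \<theta> ^ L * f (cos \<theta> *\<^sub>R x + sin \<theta> *\<^sub>R e))"
  using assms
proof (induction rule: poly_funs_induct)
  case zero
  show ?case by (intro exI[of _ 0]) simp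
next
  case (add f g)
  then obtain p q where "degree p \<le> 2 * L" "degree q \<le> 2 * L"
    "\<forall>\<theta>. poly p (cis \<theta>) = cis \<theta> ^ L * f (cos \<theta> *\<^sub>R x + sin \<theta> *\<^sub>R e)"
    "\<forall>\<theta>. poly q (cis \<theta>) = cis \<theta> ^ L * g (cos \<theta> *\<^sub>R x + sin \<theta> *\<^sub>R e)" by blast
  then show ?case
    by (intro exI[of _ "p + q"]) (auto simp: algebra_simps intro: degree_add_le)
next
  case (cmult c f)
  then obtain p where "degree p \<le> 2 * L"
    "\<forall>\<theta>. poly p (cis \<theta>) = cis \<theta> ^ L * f (cos \<theta> *\<^sub>R x + sin \<theta> *\<^sub>R e)" by blast
  then show ?case
    by (intro exI[of _ "Polynomial.smult c p"]) (auto simp: algebra_simps intro: order.trans[OF degree_smult_le])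
next
  case (monomial \<alpha>)
  define m where "m = (\<Sum>b\<in>Basis. \<alpha> b)"
  define q where "q = (\<lambda>b. [: (inner x b + \<i> * inner e b) / 2, 0, (inner x b - \<i> * inner e b) / 2 :])"
  define p where "p = monom 1 (L - m) * (\<Prod>b\<in>Basis. q b ^ \<alpha> b)"
  have q: "poly (q b) (cis \<theta>) = cis \<theta> * complex_of_real (inner (cos \<theta> *\<^sub>R x + sin \<theta> *\<^sub>R e) b)" for b \<theta>
  proof -
    have "poly (q b) (cis \<theta>) = inner x b * ((1 + cis \<theta> ^ 2) / 2) + inner e b * (\<i> * (1 - cis \<theta> ^ 2) / 2)"
      by (simp add: q_def field_simps power2_eq_square)
    also have "(1 + cis \<theta> ^ 2) / 2 = cis \<theta> * cos \<theta>"
      using sin_cos_squared_add[of \<theta>] by (simp add: complex_eq_iff power2_eq_square algebra_simps)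
    also have "\<i> * (1 - cis \<theta> ^ 2) / 2 = cis \<theta> * sin \<theta>"
      using sin_cos_squared_add[of \<theta>] by (simp add: complex_eq_iff power2_eq_square algebra_simps)
    finally show ?thesis by (simp add: inner_add_left algebra_simps)
  qed
  have "degree p \<le> (L - m) + (\<Sum>b\<in>(Basis::'a set). 2 * \<alpha> b)"
    unfolding p_def
  proof (intro order.trans[OF degree_mult_le] add_mono degree_monom_le order.trans[OF degree_prod_sum_le] sum_mono)
    fix b :: 'a
    have "degree (q b ^ \<alpha> b) \<le> degree (q b) * \<alpha> b" by (rule degree_power_le)
    also have "degree (q b) \<le> 2" by (simp add: q_def)
    finally show "(degree \<circ> (\<lambda>b. q b ^ \<alpha> b)) b \<le> 2 * \<alpha> b" by simp
  qed auto
  also have "\<dots> \<le> 2 * L"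
    using monomial by (simp add: m_def flip: sum_distrib_left)
  finally have "degree p \<le> 2 * L" .
  moreover have "poly p (cis \<theta>) = cis \<theta> ^ L * monomial_fun \<alpha> (cos \<theta> *\<^sub>R x + sin \<theta> *\<^sub>R e)" for \<theta>
  proof -
    have "poly p (cis \<theta>) = cis \<theta> ^ (L - m) * (cis \<theta> ^ m * monomial_fun \<alpha> (cos \<theta> *\<^sub>R x + sin \<theta> *\<^sub>R e))"
      unfolding p_def poly_mult poly_prod poly_power poly_monom q monomial_fun_def power_mult_distrib prod.distrib m_def power_sum
      by simp
    also have "\<dots> = cis \<theta> ^ L * monomial_fun \<alpha> (cos \<theta> *\<^sub>R x + sin \<theta> *\<^sub>R e)"
      using monomial by (simp add: m_def flip: mult.assoc power_add)
    finally show ?thesis .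
  qed
  ultimately show ?case by blast
qed

text \<open>
  The unit vector \<open>e\<close> is the normalized part of \<open>y\<close> orthogonal to \<open>x\<close>; it exists because the points are
  neither equal nor antipodal. Both distances are chords of the same angle \<open>\<alpha>\<close>.
\<close>

lemma great_circle_through:
  fixes x y :: "'a::euclidean_space"
  assumes x: "x \<in> sphere 0 1" and y: "y \<in> sphere 0 1" and neq: "y \<noteq> x" "y \<noteq> - x"
  obtains e \<alpha> where "\<And>\<theta>. cos \<theta> *\<^sub>R x + sin \<theta> *\<^sub>R e \<in> sphere 0 1"
    "y = cos \<alpha> *\<^sub>R x + sin \<alpha> *\<^sub>R e" "dist 1 (cis \<alpha>) = dist x y"
proof -
  define c where "c = inner x y"
  define v where "v = y - c *\<^sub>R x"
  have nx: "norm x = 1" "inner x x = 1" and ny: "norm y = 1" "inner y y = 1"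
    using x y by (auto simp: norm_eq_1)
  have c: "\<bar>c\<bar> \<le> 1" using Cauchy_Schwarz_ineq2[of x y] nx ny by (simp add: c_def)
  have xv: "inner x v = 0" by (simp add: v_def inner_diff_right nx c_def)
  have v: "v \<noteq> 0"
  proof
    assume "v = 0"
    then have y': "y = c *\<^sub>R x" by (simp add: v_def)
    then have "\<bar>c\<bar> = 1" using nx ny by simp
    then have "y = x \<or> y = - x" unfolding y' by (auto simp: abs_if split: if_splits)
    with neq show False by blast
  qed
  define e where "e = v /\<^sub>R norm v"
  define \<alpha> where "\<alpha> = arccos c"
  have ca: "cos \<alpha> = c" using c by (simp add: \<alpha>_def)
  have "(norm v)\<^sup>2 = 1 - c\<^sup>2"
    unfolding power2_norm_eq_inner v_def
    by (simp add: inner_diff_left inner_diff_right nx ny inner_commute[of y x] flip: c_def)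
       (simp add: power2_eq_square)
  then have sa: "sin \<alpha> = norm v"
    using c by (simp add: \<alpha>_def sin_arccos abs_le_iff) (metis norm_ge_zero real_sqrt_unique)
  have e: "inner e e = 1" "inner x e = 0"
    using v xv by (auto simp: e_def simp flip: power2_norm_eq_inner)
  show ?thesis
  proof (rule that[of e \<alpha>])
    fix \<theta>
    have "inner (cos \<theta> *\<^sub>R x + sin \<theta> *\<^sub>R e) (cos \<theta> *\<^sub>R x + sin \<theta> *\<^sub>R e) = 1"
      using sin_cos_squared_add[of \<theta>]
      by (simp add: inner_add_left inner_add_right nx e inner_commute[of e x] power2_eq_square)
    then show "cos \<theta> *\<^sub>R x + sin \<theta> *\<^sub>R e \<in> sphere 0 1" by (simp add: norm_eq_1)
  next
    show "y = cos \<alpha> *\<^sub>R x + sin \<alpha> *\<^sub>R e" using v by (simp add: ca sa e_def v_def)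
    have "(dist 1 (cis \<alpha>))\<^sup>2 = (dist x y)\<^sup>2"
    proof -
      have "(dist 1 (cis \<alpha>))\<^sup>2 = 2 - 2 * c"
        unfolding dist_norm cmod_power2 using sin_cos_squared_add[of \<alpha>]
        by (simp add: ca power2_eq_square algebra_simps)
      also have "\<dots> = (dist x y)\<^sup>2"
        unfolding dist_norm power2_norm_eq_inner
        by (simp add: inner_diff_left inner_diff_right nx ny inner_commute[of y x] flip: c_def)
      finally show ?thesis .
    qed
    then show "dist 1 (cis \<alpha>) = dist x y" by simp
  qed
qed

text \<open>
  The one-dimensional statement applied on the great circle through both points. The degree bound
  \<open>2 * L + 1\<close> in place of \<open>2 * L\<close> covers \<open>L = 0\<close>. Antipodal points lie on no distinguished great circle, but
  their distance is \<open>2\<close>.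
\<close>

lemma dist_zero_from_sphere_max:
  fixes x y :: "'a::euclidean_space"
  assumes f: "f \<in> poly_funs L" and bd: "\<And>u. u \<in> sphere 0 1 \<Longrightarrow> norm (f u) \<le> 1"
    and x: "x \<in> sphere 0 1" "norm (f x) = 1" and y: "y \<in> sphere 0 1" "f y = 0"
  shows "1 / (6 * real L + 3) \<le> dist x y"
proof (cases "y = - x")
  case True
  have "dist x (-x) = 2" using x norm_scaleR[of 2 x] by (simp add: dist_norm flip: scaleR_2)
  moreover have "1 / (6 * real L + 3) \<le> 2" by (simp add: divide_le_eq)
  ultimately show ?thesis using True by simp
next
  case False
  have "y \<noteq> x" using x y by auto
  then obtain e \<alpha> where e: "\<And>\<theta>. cos \<theta> *\<^sub>R x + sin \<theta> *\<^sub>R e \<in> sphere 0 1"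
    and \<alpha>: "y = cos \<alpha> *\<^sub>R x + sin \<alpha> *\<^sub>R e" "dist 1 (cis \<alpha>) = dist x y"
    using great_circle_through[OF x(1) y(1) _ False] by metis
  obtain p where p: "degree p \<le> 2 * L"
    "\<And>\<theta>. poly p (cis \<theta>) = cis \<theta> ^ L * f (cos \<theta> *\<^sub>R x + sin \<theta> *\<^sub>R e)"
    using poly_funs_great_circle[OF f, of x e] by blast
  have "1 \<le> 3 * real (2 * L + 1) * dist 1 (cis \<alpha>)"
  proof (rule dist_zero_from_unit_circle_max)
    show "degree p \<le> 2 * L + 1" using p(1) by simp
    fix u :: complex assume u: "norm u = 1"
    then have "u = cis (Arg u)" using rcis_cmod_Arg[of u] by (simp add: rcis_def)
    then show "norm (poly p u) \<le> 1"
      using p(2)[of "Arg u"] bd[OF e[of "Arg u"]] u by (simp add: norm_mult norm_power)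
  next
    show "poly p (cis \<alpha>) = 0" using p(2)[of \<alpha>] \<alpha> y by simp
    show "norm (poly p 1) = 1" using p(2)[of 0] x by simp
  qed auto
  then show ?thesis by (simp add: \<alpha> field_simps)
qed

section \<open>Lagrange functions and separation of Fekete points\<close>

text \<open>
  The Laplace expansion along the column of the replaced point: as a function of this point, the
  determinant is a combination of the functions \<open>Q i\<close> whose coefficients depend on the other
  points only.
\<close>

lemma det_replace_point:
  fixes Q :: "nat \<Rightarrow> 'x \<Rightarrow> complex"
  assumes "k < N"
  shows "Determinant.det (Matrix.mat N N (\<lambda>(i, j). Q i ((z(k := x)) j)))
    = (\<Sum>i<N. cofactor (Matrix.mat N N (\<lambda>(i, j). Q i (z j))) i k * Q i x)"
proof -
  let ?A = "Matrix.mat N N (\<lambda>(i, j). Q i ((z(k := x)) j))"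
  have "mat_delete ?A i k = mat_delete (Matrix.mat N N (\<lambda>(i, j). Q i (z j))) i k" if "i < N" for i
    using that assms by (intro eq_matI) (auto simp: mat_delete_def)
  then have "cofactor ?A i k = cofactor (Matrix.mat N N (\<lambda>(i, j). Q i (z j))) i k" if "i < N" for i
    using that by (simp add: cofactor_def)
  moreover have "Determinant.det ?A = (\<Sum>i<N. ?A $$ (i, k) * cofactor ?A i k)"
    using assms by (intro laplace_expansion_column) auto
  ultimately show ?thesis
    using assms by (simp add: mult.commute)
qed

text \<open>
  Independence is already visible on as many points as there are functions. In the induction step, the
  determinant as a function of the new point has a nonzero coefficient at \<open>Q N\<close>, namely the
  determinant for the previous points, so independence prevents it from vanishing identically.
\<close>

lemma ex_det_nonzero:
  fixes Q :: "nat \<Rightarrow> 'x \<Rightarrow> complex"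
  assumes "\<And>a. (\<And>x. x \<in> S \<Longrightarrow> (\<Sum>i<N. a i * Q i x) = 0) \<Longrightarrow> \<forall>i<N. a i = 0"
  shows "\<exists>z. (\<forall>j<N. z j \<in> S) \<and> Determinant.det (Matrix.mat N N (\<lambda>(i, j). Q i (z j))) \<noteq> 0"
  using assms
proof (induction N)
  case 0
  show ?case by (simp add: det_dim_zero)
next
  case (Suc N)
  have "\<forall>i<N. a i = 0" if "\<And>x. x \<in> S \<Longrightarrow> (\<Sum>i<N. a i * Q i x) = 0" for a
  proof -
    have "(\<Sum>i<Suc N. (a(N := 0)) i * Q i x) = (\<Sum>i<N. a i * Q i x)" for x by simp
    then have "\<forall>i<Suc N. (a(N := 0)) i = 0"
      using Suc.prems[of "a(N := 0)"] that by simp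
    then show ?thesis by (metis fun_upd_other less_SucI less_irrefl)
  qed
  from Suc.IH[OF this] obtain z where z: "\<forall>j<N. z j \<in> S"
    and nz: "Determinant.det (Matrix.mat N N (\<lambda>(i, j). Q i (z j))) \<noteq> 0" by blast
  let ?B = "Matrix.mat (Suc N) (Suc N) (\<lambda>(i, j). Q i (z j))"
  have "mat_delete ?B N N = Matrix.mat N N (\<lambda>(i, j). Q i (z j))"
    by (intro eq_matI) (auto simp: mat_delete_def)
  then have "cofactor ?B N N \<noteq> 0" using nz by (simp add: cofactor_def)
  then obtain x where x: "x \<in> S" "(\<Sum>i<Suc N. cofactor ?B i N * Q i x) \<noteq> 0"
    using Suc.prems[of "\<lambda>i. cofactor ?B i N"] by blast
  show ?case
    by (rule exI[of _ "z(N := x)"])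
       (use x z det_replace_point[of N "Suc N" Q z x] in \<open>auto simp: less_Suc_eq simp del: sum.lessThan_Suc\<close>)
qed

text \<open>
  By Cramer's rule, the \<open>k\<close>-th Lagrange function is the quotient of the determinant with the \<open>k\<close>-th
  point replaced by \<open>x\<close> and the maximal determinant. Hence it is bounded by \<open>1\<close> on the sphere.
\<close>

lemma fekete_lagrange:
  fixes z :: "nat \<Rightarrow> 'a::euclidean_space"
  assumes "fekete_points L z"
  shows "\<exists>l. \<forall>k < sphere_dim TYPE('a) L. l k \<in> sphere_polys L \<and>
    (\<forall>x\<in>sphere 0 1. norm (l k x) \<le> 1) \<and>
    (\<forall>j < sphere_dim TYPE('a) L. l k (z j) = (if j = k then 1 else 0))"
proof -
  define N where "N = sphere_dim TYPE('a) L"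
  obtain Q where Q: "sphere_basis L Q" and zS: "\<forall>j<N. z j \<in> sphere 0 1"
    and mx: "\<And>x. \<forall>j<N. x j \<in> sphere 0 1 \<Longrightarrow> norm (fekete_det L Q x) \<le> norm (fekete_det L Q z)"
    using assms unfolding fekete_points_def N_def by blast
  have fd: "fekete_det L Q x = Determinant.det (Matrix.mat N N (\<lambda>(i, j). Q i (x j)))" for x
    by (simp add: fekete_det_def N_def)
  have Qmem: "Q i \<in> sphere_polys L" if "i < N" for i
  proof -
    have "cfun.span (Q ` {..<N}) = sphere_polys L" using Q by (simp add: sphere_basis_def N_def)
    then show ?thesis using that cfun.span_base[of "Q i" "Q ` {..<N}"] by auto
  qed
  \<comment> \<open>The maximum is nonzero because some determinant is.\<close>
  have "\<exists>x. (\<forall>j<N. x j \<in> sphere 0 1) \<and> Determinant.det (Matrix.mat N N (\<lambda>(i, j). Q i (x j))) \<noteq> 0"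
    by (rule ex_det_nonzero) (use sphere_basis_independent[OF Q] in \<open>auto simp: N_def\<close>)
  then have nz: "fekete_det L Q z \<noteq> 0" using mx unfolding fd[symmetric] by fastforce
  define l where "l = (\<lambda>k x. fekete_det L Q (z(k := x)) / fekete_det L Q z)"
  show ?thesis
    unfolding N_def[symmetric]
  proof (intro exI[of _ l] allI impI conjI ballI)
    fix k assume k: "k < N"
    define c where "c = (\<lambda>i. cofactor (Matrix.mat N N (\<lambda>(i, j). Q i (z j))) i k / fekete_det L Q z)"
    have "l k = (\<lambda>x. \<Sum>i<N. c i * Q i x)"
      unfolding l_def fd det_replace_point[OF k] by (simp add: c_def fd sum_divide_distrib)
    also have "\<dots> \<in> sphere_polys L" by (intro sphere_polys_lincomb Qmem) auto
    finally show "l k \<in> sphere_polys L" .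
    show "norm (l k x) \<le> 1" if "x \<in> sphere 0 1" for x
      using mx[of "z(k := x)"] that zS nz by (simp add: l_def norm_divide)
    show "l k (z j) = (if j = k then 1 else 0)" if j: "j < N" for j
    proof (cases "j = k")
      case False
      let ?A = "Matrix.mat N N (\<lambda>(i, j'). Q i ((z(k := z j)) j'))"
      have "Determinant.det ?A = 0"
        by (rule det_identical_columns[OF _ False j k]) (use j k False in \<open>auto intro!: eq_vecI\<close>)
      then show ?thesis using False by (simp add: l_def fd)
    qed (use nz in \<open>simp add: l_def\<close>)
  qed
qed

text \<open>
  The \<open>i\<close>-th Lagrange function attains its maximum modulus \<open>1\<close> at \<open>z i\<close> and vanishes at \<open>z j\<close>.
\<close>

lemma fekete_separated:
  fixes z :: "nat \<Rightarrow> 'a::euclidean_space"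
  assumes z: "fekete_points L z" and ij: "i < sphere_dim TYPE('a) L" "j < sphere_dim TYPE('a) L" "i \<noteq> j"
  shows "1 / (6 * real L + 3) \<le> dist (z i) (z j)"
proof -
  obtain l where l: "\<And>k. k < sphere_dim TYPE('a) L \<Longrightarrow> l k \<in> sphere_polys L"
    "\<And>k x. k < sphere_dim TYPE('a) L \<Longrightarrow> x \<in> sphere 0 1 \<Longrightarrow> norm (l k x) \<le> 1"
    "\<And>k j. k < sphere_dim TYPE('a) L \<Longrightarrow> j < sphere_dim TYPE('a) L \<Longrightarrow> l k (z j) = (if j = k then 1 else 0)"
    using fekete_lagrange[OF z] by blast
  have S: "z i \<in> sphere 0 1" "z j \<in> sphere 0 1" using z ij unfolding fekete_points_def by auto
  obtain g where g: "g \<in> poly_funs L" "\<And>x. x \<in> sphere 0 1 \<Longrightarrow> l i x = g x"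
    using sphere_polysE[OF l(1)[OF ij(1)]] by metis
  show ?thesis
    by (rule dist_zero_from_sphere_max[OF g(1)])
       (use l ij S g(2)[symmetric] in auto)
qed

section \<open>Localized interpolation at Fekete points\<close>

text \<open>
  The functions \<open>h j\<close> are the Lagrange functions of degree \<open>k\<close>, localized by a kernel whose degree
  fits into the gap \<open>L - k\<close>. The functions \<open>w j\<close> are majorants in which the sum over \<open>j\<close> and the
  integral can be estimated. All bounds depend on \<open>\<epsilon>\<close> and the dimension only: the order \<open>n\<close> of the kernel,
  the inverse separation of the points and the degree \<open>L\<close> are comparable.
\<close>

lemma localized_interpolation:
  fixes y z :: "nat \<Rightarrow> 'a::euclidean_space" and \<epsilon> :: real
  assumes y: "fekete_points k y" and z: "fekete_points L z"
    and kL: "k \<le> L" "\<epsilon> * real L \<le> real (L - k)" and \<epsilon>: "0 < \<epsilon>" "\<epsilon> \<le> 1" and dim: "DIM('a) \<ge> 2"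
  defines "D \<equiv> DIM('a)"
  defines "A \<equiv> (5 * (5 * (3 + 2 * (9 * (real D)\<^sup>2 / \<epsilon>)\<^sup>2))) ^ D"
    and "B \<equiv> 5 ^ D * (real D * 3 ^ D * decay_mass ^ D) * (real D * 2 ^ D * (18 * real D / \<epsilon>) ^ (D - 1))"
  shows "\<exists>h w. (\<forall>j < sphere_dim TYPE('a) k. h j \<in> sphere_polys L \<and>
      (\<forall>i < sphere_dim TYPE('a) k. h j (y i) = (if i = j then 1 else 0)) \<and>
      (\<forall>x\<in>sphere 0 1. norm (h j x) \<le> w j x) \<and>
      (\<forall>x. 0 \<le> w j x) \<and> w j \<in> borel_measurable borel \<and>
      (\<integral>\<^sup>+x. ennreal (w j x) \<partial>sphere_measure) \<le> ennreal (B / sphere_dim TYPE('a) L)) \<and>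
    (\<forall>x. (\<Sum>j < sphere_dim TYPE('a) k. w j x) \<le> A)"
proof -
  define m where "m = sphere_dim TYPE('a) k"
  define M where "M = sphere_dim TYPE('a) L"
  \<comment> \<open>the largest order for which \<open>D\<close> factors of degree less than \<open>n\<close> fit into the gap\<close>
  define n where "n = (L - k) div D + 1"
  have D: "D \<ge> 2" "D > 0" using dim by (auto simp: D_def)
  have n: "n \<ge> 1" by (simp add: n_def)
  have degn: "D * (n - 1) \<le> L - k" by (simp add: n_def)
  have "L - k \<le> D * n"
    using D(2) dividend_less_times_div[of D "L - k"] by (simp add: n_def)
  then have "real (L - k) \<le> real D * real n" by (metis of_nat_le_iff of_nat_mult)
  moreover have "1 * 1 \<le> real D * real n" using D n by (intro mult_mono) auto
  \<comment> \<open>The form \<open>2 * L + 1\<close> matches the separation \<open>1 / (3 * (2 * L + 1))\<close> and includes \<open>L = 0\<close>.\<close>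
  ultimately have nL: "\<epsilon> * (2 * real L + 1) \<le> 3 * real D * real n"
    using kL \<epsilon> by (simp add: algebra_simps)
  define \<delta> where "\<delta> = 1 / (6 * real L + 3)"
  have \<delta>: "0 < \<delta>" "\<delta> \<le> 2" by (auto simp: \<delta>_def divide_le_eq)
  have yS: "y j \<in> sphere 0 1" if "j < m" for j using y that by (simp add: fekete_points_def m_def)
  have zS: "z j \<in> sphere 0 1" if "j < M" for j using z that by (simp add: fekete_points_def M_def)
  have ysep: "\<delta> \<le> dist (y i) (y j)" if "i < m" "j < m" "i \<noteq> j" for i j
  proof -
    have "\<delta> \<le> 1 / (6 * real k + 3)" unfolding \<delta>_def using kL by (intro divide_left_mono) auto
    also have "\<dots> \<le> dist (y i) (y j)" using that by (intro fekete_separated y) (auto simp: m_def)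
    finally show ?thesis .
  qed
  obtain p :: "real poly" where p: "degree p < n" "poly p 1 = 1"
    "\<And>x z :: 'a. x \<in> sphere 0 1 \<Longrightarrow> z \<in> sphere 0 1 \<Longrightarrow>
       0 \<le> poly p (inner x z) \<and> poly p (inner x z) \<le> 5 * (1 / (1 + (real n * dist x z)\<^sup>2))"
    using localizing_kernel[OF n] by blast
  obtain l where l: "\<And>j. j < m \<Longrightarrow> l j \<in> sphere_polys k"
    "\<And>j x. j < m \<Longrightarrow> x \<in> sphere 0 1 \<Longrightarrow> norm (l j x) \<le> 1"
    "\<And>j i. j < m \<Longrightarrow> i < m \<Longrightarrow> l j (y i) = (if i = j then 1 else 0)"
    using fekete_lagrange[OF y] unfolding m_def by blast
  define h where "h = (\<lambda>j x. complex_of_real (poly (p ^ D) (inner x (y j))) * l j x)"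
  define w where "w = (\<lambda>j x. 5 ^ D * (1 / (1 + (real n * dist x (y j))\<^sup>2)) ^ D)"
  have w0: "0 \<le> w j x" for j x by (simp add: w_def)
  have wm: "w j \<in> borel_measurable borel" for j unfolding w_def by measurable
  have hpoly: "h j \<in> sphere_polys L" if "j < m" for j
  proof -
    have "degree (p ^ D) \<le> degree p * D" by (rule degree_power_le)
    also have "\<dots> \<le> D * (n - 1)" using p(1) by (subst mult.commute) (intro mult_le_mono2, linarith)
    also have "\<dots> \<le> L - k" by (rule degn)
    finally have "h j \<in> sphere_polys ((L - k) + k)"
      unfolding h_def by (intro sphere_polys_mult poly_funs_zonal l(1) that)
    then show ?thesis using kL by simp
  qed
  have hval: "h j (y i) = (if i = j then 1 else 0)" if "j < m" "i < m" for i j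
    using l(3)[OF that] yS[OF that(1)] p(2) by (auto simp: h_def norm_eq_1)
  have hw: "norm (h j x) \<le> w j x" if j: "j < m" and x: "x \<in> sphere 0 1" for j x
  proof -
    have "norm (h j x) = poly p (inner x (y j)) ^ D * norm (l j x)"
      using p(3)[OF x yS[OF j]] by (simp add: h_def norm_mult norm_power)
    also have "\<dots> \<le> (5 * (1 / (1 + (real n * dist x (y j))\<^sup>2))) ^ D * 1"
      using p(3)[OF x yS[OF j]] l(2)[OF j x] by (intro mult_mono power_mono) auto
    also have "\<dots> = w j x" unfolding w_def by (subst power_mult_distrib) simp
    finally show ?thesis .
  qed
  have sum: "(\<Sum>j<m. w j x) \<le> A" for x
  proof -
    define c where "c = \<epsilon> / (9 * real D)"
    have c: "c > 0" using \<epsilon> D by (simp add: c_def)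
    have "c \<le> real n * \<delta>" using nL D by (simp add: c_def \<delta>_def field_simps)
    have "(\<Sum>j<m. w j x) \<le> (\<Sum>j<m. 5 ^ D * decay (real n *\<^sub>R (x - y j)))"
    proof (rule sum_mono)
      fix j
      show "w j x \<le> 5 ^ D * decay (real n *\<^sub>R (x - y j))"
        using decay_ge[of "real n *\<^sub>R (x - y j)"]
        unfolding w_def D_def by (intro mult_left_mono) (auto simp: dist_norm)
    qed
    also have "\<dots> = 5 ^ D * (\<Sum>j<m. decay (real n *\<^sub>R (x - y j)))" by (simp add: sum_distrib_left)
    also have "(\<Sum>j<m. decay (real n *\<^sub>R (x - y j))) \<le> (5 * (3 + 2 * (D / c)\<^sup>2)) ^ D"
      unfolding D_def
    proof (rule separated_decay_sum)
      fix i j assume ij: "i \<in> {..<m}" "j \<in> {..<m}" "i \<noteq> j"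
      have "c \<le> real n * \<delta>" by fact
      also have "\<dots> \<le> real n * dist (y i) (y j)" using ysep ij by (intro mult_left_mono) auto
      also have "\<dots> = dist (real n *\<^sub>R (x - y i)) (real n *\<^sub>R (x - y j))"
        by (simp add: dist_norm norm_minus_commute flip: scaleR_diff_right)
      finally show "c \<le> dist (real n *\<^sub>R (x - y i)) (real n *\<^sub>R (x - y j))" .
    qed (use c in auto)
    also have "5 ^ D * (5 * (3 + 2 * (D / c)\<^sup>2)) ^ D = A"
    proof -
      have "D / c = 9 * (real D)\<^sup>2 / \<epsilon>" by (simp add: c_def power2_eq_square)
      then show ?thesis unfolding A_def by (simp only: power_mult_distrib)
    qed
    finally show ?thesis by simp
  qed
  have int: "(\<integral>\<^sup>+x. ennreal (w j x) \<partial>sphere_measure) \<le> ennreal (B / M)" if j: "j < m" for j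
  proof -
    define E where "E = 5 ^ D * (real D * 3 ^ D * decay_mass ^ D)"
    define F where "F = real D * 2 ^ D * (18 * real D / \<epsilon>) ^ (D - 1)"
    have E: "E \<ge> 0" by (simp add: E_def decay_mass_def)
    obtain Q :: "nat \<Rightarrow> 'a \<Rightarrow> complex" where "sphere_basis L Q" using z by (auto simp: fekete_points_def)
    then have M: "M > 0" unfolding M_def using sphere_dim_gt dim by fastforce
    \<comment> \<open>The dimension is the number of Fekete points of degree \<open>L\<close>, which are separated.\<close>
    have "real M \<le> real D * 2 ^ D * (2 / \<delta>) ^ (D - 1)"
      unfolding D_def using card_separated_sphere[of "{..<M}" \<delta> z] \<delta> zS fekete_separated[OF z]
      by (simp add: M_def \<delta>_def)
    also have "\<dots> \<le> real D * 2 ^ D * (18 * real D / \<epsilon> * real n) ^ (D - 1)"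
      using nL \<epsilon> by (intro mult_left_mono power_mono) (auto simp: \<delta>_def field_simps)
    also have "\<dots> = F * real n ^ (D - 1)" unfolding F_def power_mult_distrib by simp
    finally have "real M \<le> F * real n ^ (D - 1)" .
    then have "1 / real n ^ (D - 1) \<le> F / M" using n M by (simp add: field_simps)
    then have le: "E * (1 / real n ^ (D - 1)) \<le> E * (F / M)" using E by (rule mult_left_mono)
    have "(\<integral>\<^sup>+x. ennreal (w j x) \<partial>sphere_measure) 
      = ennreal (5 ^ D) * (\<integral>\<^sup>+x. ennreal ((1 / (1 + (real n * dist x (y j))\<^sup>2)) ^ D) \<partial>sphere_measure)"
    proof -
      have "(\<lambda>x. (1 / (1 + (real n * dist x (y j))\<^sup>2)) ^ D) \<in> borel_measurable borel" by measurable
      then have "(\<lambda>x. ennreal ((1 / (1 + (real n * dist x (y j))\<^sup>2)) ^ D)) \<in> borel_measurable sphere_measure"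
        by (intro measurable_sphere_measure) simp
      then show ?thesis
        unfolding w_def by (subst nn_integral_cmult[symmetric]) (auto simp: ennreal_mult)
    qed
    also have "\<dots> \<le> ennreal (5 ^ D) * ennreal (D * 3 ^ D * decay_mass ^ D / real n ^ (D - 1))"
      unfolding D_def by (intro mult_left_mono sphere_decay_integral yS j n) auto
    also have "\<dots> = ennreal (E * (1 / real n ^ (D - 1)))"
      by (simp add: E_def decay_mass_def flip: ennreal_mult)
    also have "\<dots> \<le> ennreal (B / M)" using le by (intro ennreal_leI) (simp add: B_def E_def F_def)
    finally show ?thesis .
  qed
  show ?thesis
    unfolding m_def[symmetric] M_def[symmetric]
    by (rule exI[of _ h], rule exI[of _ w]) (use hpoly hval hw w0 wm int sum in auto)
qed

section \<open>Weighted sums in Lebesgue spaces\<close>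

text \<open>
  Jensen's inequality for the weights \<open>w\<close> normalized by their sum.
\<close>

lemma sum_powr_le:
  fixes a w :: "'i \<Rightarrow> real"
  assumes "finite J" and p: "p \<ge> 1" and a: "\<And>j. j \<in> J \<Longrightarrow> 0 \<le> a j" and w: "\<And>j. j \<in> J \<Longrightarrow> 0 \<le> w j"
    and A: "(\<Sum>j\<in>J. w j) \<le> A"
  shows "(\<Sum>j\<in>J. a j * w j) powr p \<le> A powr (p - 1) * (\<Sum>j\<in>J. a j powr p * w j)"
proof -
  \<comment> \<open>The power is used as a convex function on the open half line, so zero values are dropped first.\<close>
  define J' where "J' = {j\<in>J. a j > 0}"
  define W where "W = (\<Sum>j\<in>J'. w j)"
  have fin: "finite J'" using assms(1) by (simp add: J'_def)
  have "W \<le> (\<Sum>j\<in>J. w j)" unfolding W_def J'_def using assms(1) w by (intro sum_mono2) auto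
  then have WA: "W \<le> A" using A by simp
  have W0: "0 \<le> W" unfolding W_def J'_def using w by (intro sum_nonneg) auto
  have eq1: "(\<Sum>j\<in>J. a j * w j) = (\<Sum>j\<in>J'. a j * w j)"
    unfolding J'_def using assms(1) a by (intro sum.mono_neutral_right) (auto simp: less_le)
  have eq2: "(\<Sum>j\<in>J. a j powr p * w j) = (\<Sum>j\<in>J'. a j powr p * w j)"
    unfolding J'_def using assms(1) a by (intro sum.mono_neutral_right) (auto simp: less_le)
  have nn: "0 \<le> (\<Sum>j\<in>J'. a j powr p * w j)" unfolding J'_def using w by (intro sum_nonneg) auto
  show ?thesis
  proof (cases "W = 0")
    case True
    then have "\<forall>j\<in>J'. w j = 0" unfolding W_def using fin w by (subst (asm) sum_nonneg_eq_0_iff) (auto simp: J'_def)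
    then show ?thesis by (simp add: eq1 eq2)
  next
    case False
    then have W: "W > 0" using W0 by simp
    have ne: "J' \<noteq> {}" using False by (auto simp: W_def)
    have "(\<Sum>j\<in>J'. (w j / W) *\<^sub>R a j) powr p \<le> (\<Sum>j\<in>J'. (w j / W) * (a j powr p))"
    proof (rule convex_on_sum[OF fin ne powr_convex[OF p]])
      show "(\<Sum>j\<in>J'. w j / W) = 1" using W by (simp add: W_def flip: sum_divide_distrib)
    qed (use w W in \<open>auto simp: J'_def\<close>)
    then have "((\<Sum>j\<in>J'. a j * w j) / W) powr p \<le> (\<Sum>j\<in>J'. a j powr p * w j) / W"
      by (simp add: sum_divide_distrib mult.commute)
    moreover have "0 \<le> (\<Sum>j\<in>J'. a j * w j)" unfolding J'_def using w by (intro sum_nonneg) auto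
    ultimately have "(\<Sum>j\<in>J'. a j * w j) powr p / W powr p \<le> (\<Sum>j\<in>J'. a j powr p * w j) / W"
      using W by (simp add: powr_divide)
    then have "(\<Sum>j\<in>J'. a j * w j) powr p \<le> W powr p / W * (\<Sum>j\<in>J'. a j powr p * w j)"
      using W by (simp add: field_simps)
    also have "W powr p / W = W powr (p - 1)" using W by (simp add: powr_diff)
    also have "W powr (p - 1) * (\<Sum>j\<in>J'. a j powr p * w j) \<le> A powr (p - 1) * (\<Sum>j\<in>J'. a j powr p * w j)"
      using W0 WA p nn by (intro mult_right_mono powr_mono2) auto
    finally show ?thesis by (simp add: eq1 eq2)
  qed
qed

text \<open>
  This is the interpolation between \<open>L\<^sup>1\<close> and \<open>L\<^sup>\<infinity>\<close> for the operator with kernel \<open>w\<close>: a bound on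
  its row sums and a bound on its column integrals control all exponents in between.
\<close>

lemma nn_integral_weighted_sum_powr_le:
  fixes w :: "'i \<Rightarrow> 'x \<Rightarrow> real"
  assumes J: "finite J" and q: "q \<ge> 1" and a: "\<And>j. j \<in> J \<Longrightarrow> 0 \<le> a j" and w: "\<And>j x. j \<in> J \<Longrightarrow> 0 \<le> w j x"
    and wm[measurable]: "\<And>j. j \<in> J \<Longrightarrow> w j \<in> borel_measurable M"
    and A: "\<And>x. x \<in> space M \<Longrightarrow> (\<Sum>j\<in>J. w j x) \<le> A"
    and b: "b \<ge> 0" "\<And>j. j \<in> J \<Longrightarrow> (\<integral>\<^sup>+x. ennreal (w j x) \<partial>M) \<le> ennreal b"
  shows "(\<integral>\<^sup>+x. ennreal ((\<Sum>j\<in>J. a j * w j x) powr q) \<partial>M) \<le> ennreal (A powr (q - 1) * (b * (\<Sum>j\<in>J. a j powr q)))"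
proof -
  have "(\<integral>\<^sup>+x. ennreal ((\<Sum>j\<in>J. a j * w j x) powr q) \<partial>M)
    \<le> (\<integral>\<^sup>+x. (\<Sum>j\<in>J. ennreal (A powr (q - 1) * a j powr q) * ennreal (w j x)) \<partial>M)"
  proof (rule nn_integral_mono)
    fix x assume x: "x \<in> space M"
    have "ennreal ((\<Sum>j\<in>J. a j * w j x) powr q) \<le> ennreal (A powr (q - 1) * (\<Sum>j\<in>J. a j powr q * w j x))"
      by (intro ennreal_leI sum_powr_le J q a w A x)
    also have "\<dots> = (\<Sum>j\<in>J. ennreal (A powr (q - 1) * a j powr q) * ennreal (w j x))"
      using w by (simp add: sum_distrib_left mult.assoc sum_ennreal flip: ennreal_mult)
    finally show "ennreal ((\<Sum>j\<in>J. a j * w j x) powr q) \<le> (\<Sum>j\<in>J. ennreal (A powr (q - 1) * a j powr q) * ennreal (w j x))" .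
  qed
  also have "\<dots> = (\<Sum>j\<in>J. ennreal (A powr (q - 1) * a j powr q) * (\<integral>\<^sup>+x. ennreal (w j x) \<partial>M))"
    by (subst nn_integral_sum) (auto intro!: sum.cong nn_integral_cmult)
  also have "\<dots> \<le> (\<Sum>j\<in>J. ennreal (A powr (q - 1) * a j powr q) * ennreal b)"
    by (intro sum_mono mult_left_mono b) auto
  also have "\<dots> = ennreal (A powr (q - 1) * (b * (\<Sum>j\<in>J. a j powr q)))"
    using b by (simp add: sum_distrib_left mult_ac sum_ennreal flip: ennreal_mult)
  finally show ?thesis .
qed

lemma Lp_norm_le:
  assumes "p \<noteq> \<infinity>" "K \<ge> 0" "(\<integral>\<^sup>+x. ennreal (norm (f x) powr enn2real p) \<partial>M) \<le> ennreal K"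
  shows "Lp_norm M p f \<le> ennreal (K powr (1 / enn2real p))"
proof -
  define I where "I = (\<integral>\<^sup>+x. ennreal (norm (f x) powr enn2real p) \<partial>M)"
  have I: "I \<le> ennreal K" using assms by (simp add: I_def)
  then have "I \<noteq> \<infinity>" using ennreal_less_top[of K] by (auto simp: top_unique)
  moreover have "enn2real I \<le> K" using I assms(2) by (rule enn2real_leI[rotated])
  ultimately show ?thesis
    using assms(1) by (simp add: Lp_norm_def flip: I_def) (intro ennreal_leI powr_mono2; simp)
qed

section \<open>Interpolation with Fekete points of lower degree\<close>

lemma deg_minus_bounds:
  assumes "0 < \<epsilon>" "\<epsilon> < 1"
  shows "deg_minus \<epsilon> L \<le> L" "\<epsilon> * real L \<le> real (L - deg_minus \<epsilon> L)"
    and "filterlim (deg_minus \<epsilon>) at_top at_top"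
proof -
  have "0 \<le> (1 - \<epsilon>) * real L" using assms by simp
  then have le: "real (deg_minus \<epsilon> L) \<le> (1 - \<epsilon>) * real L" 
    unfolding deg_minus_def by (simp add: of_nat_nat)
  also have "\<dots> \<le> real L" using assms by (simp add: mult_left_le_one_le)
  finally show 1: "deg_minus \<epsilon> L \<le> L" by simp
  show "\<epsilon> * real L \<le> real (L - deg_minus \<epsilon> L)"
    using le 1 by (simp add: of_nat_diff algebra_simps)
  show "filterlim (deg_minus \<epsilon>) at_top at_top"
    unfolding filterlim_at_top
  proof
    fix Z :: nat
    show "eventually (\<lambda>L. Z \<le> deg_minus \<epsilon> L) at_top"
    proof (rule eventually_sequentiallyI)
      fix L assume "nat \<lceil>real Z / (1 - \<epsilon>)\<rceil> \<le> L"
      then have "real Z / (1 - \<epsilon>) \<le> real L" by linarith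
      then have "real Z \<le> (1 - \<epsilon>) * real L" using assms by (simp add: field_simps)
      then show "Z \<le> deg_minus \<epsilon> L" unfolding deg_minus_def by (simp add: le_nat_iff le_floor_iff)
    qed
  qed
qed

theorem theorem2p3:
  fixes d :: nat
    and \<epsilon> :: real
    and z :: "nat \<Rightarrow> nat \<Rightarrow> 'a::euclidean_space"
  assumes "d \<ge> 1"
    and "DIM('a) = d + 1"
    and "\<And>L. fekete_points L (z L)"
    and "0 < \<epsilon>" and "\<epsilon> < 1"
  shows "\<forall>p::ennreal. 1 \<le> p \<longrightarrow>
    Lp_interpolating p (\<lambda>L. sphere_dim TYPE('a) (deg_minus \<epsilon> L)) (\<lambda>L. z (deg_minus \<epsilon> L))"
proof (intro allI impI)
  fix p :: ennreal assume p: "1 \<le> p"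
  define k where "k = deg_minus \<epsilon>"
  define N where "N = sphere_dim TYPE('a)"
  have dim: "DIM('a) \<ge> 2" using assms(1,2) by simp
  note fek = assms(3)
  note k = deg_minus_bounds[OF assms(4,5), folded k_def]
  have basis: "\<exists>Q :: nat \<Rightarrow> 'a \<Rightarrow> complex. sphere_basis L Q" for L
    using fek[of L] by (auto simp: fekete_points_def)
  have N_gt: "L < N L" for L
    using basis[of L] sphere_dim_gt[OF _ dim] by (auto simp: N_def)
  have N_mono: "N (k L) \<le> N L" for L
    using basis[of L] sphere_dim_le[OF _ sphere_polys_mono[OF k(1)], of L]
    by (auto simp: N_def sphere_dim_def)
  have arr: "triangular_array (\<lambda>L. N (k L)) (\<lambda>L. z (k L))"
    unfolding triangular_array_def
  proof (intro conjI allI impI)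
    fix L j assume "j < N (k L)"
    then show "z (k L) j \<in> sphere 0 1" using fek[of "k L"] by (auto simp: fekete_points_def N_def)
  next
    fix L
    show "inj_on (z (k L)) {..<N (k L)}"
    proof (rule inj_onI, rule ccontr)
      fix i j assume ij: "i \<in> {..<N (k L)}" "j \<in> {..<N (k L)}" "z (k L) i = z (k L) j" "i \<noteq> j"
      have "1 / (6 * real (k L) + 3) \<le> dist (z (k L) i) (z (k L) j)"
        using ij by (intro fekete_separated fek) (auto simp: N_def)
      moreover have "0 < 1 / (6 * real (k L) + 3)" by simp
      ultimately show False using ij(3) by simp
    qed
  next
    show "filterlim (\<lambda>L. N (k L)) at_top at_top"
      by (rule filterlim_at_top_mono[OF k(3)]) (intro always_eventually allI less_imp_le N_gt)
  qed
  define D where "D = DIM('a)"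
  define A where "A = (5 * (5 * (3 + 2 * (9 * (real D)\<^sup>2 / \<epsilon>)\<^sup>2))) ^ D"
  define B where "B = 5 ^ D * (real D * 3 ^ D * decay_mass ^ D) * (real D * 2 ^ D * (18 * real D / \<epsilon>) ^ (D - 1))"
  have A0: "A \<ge> 0" and B0: "B \<ge> 0" using assms(4) by (auto simp: A_def B_def decay_mass_def)
  define P where "P = (\<lambda>L h w. (\<forall>j < N (k L). h j \<in> sphere_polys L \<and>
      (\<forall>i < N (k L). h j (z (k L) i) = (if i = j then 1 else 0)) \<and>
      (\<forall>x\<in>sphere 0 1. norm (h j x) \<le> w j x) \<and>
      (\<forall>x. 0 \<le> w j x) \<and> w j \<in> borel_measurable borel \<and>
      (\<integral>\<^sup>+x. ennreal (w j x) \<partial>sphere_measure) \<le> ennreal (B / N L)) \<and>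
    (\<forall>x. (\<Sum>j < N (k L). w j x) \<le> A))"
  have "\<exists>h w. P L h w" for L
    unfolding P_def A_def B_def D_def N_def
    by (rule localized_interpolation[OF fek fek k(1,2) assms(4) less_imp_le[OF assms(5)] dim])
  then obtain h w where "\<And>L. P L (h L) (w L)" by metis
  note hw = this[unfolded P_def]
  have "\<exists>Q. (\<forall>L. Q L \<in> sphere_polys L) \<and> (SUP L. Lp_norm sphere_measure p (Q L)) < \<infinity> \<and>
         (\<forall>L. \<forall>j < N (k L). Q L (z (k L) j) = c L j)"
    if c: "Lp_bounded_values TYPE('a) p (\<lambda>L. N (k L)) c" for c
  proof -
    define Q where "Q = (\<lambda>L x. \<Sum>j < N (k L). c L j * h L j x)"
    have Qp: "Q L \<in> sphere_polys L" for L
      unfolding Q_def using hw by (intro sphere_polys_lincomb) auto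
    have Qv: "Q L (z (k L) j) = c L j" if j: "j < N (k L)" for L j
    proof -
      have "Q L (z (k L) j) = (\<Sum>i < N (k L). if i = j then c L j else 0)"
        unfolding Q_def using hw j by (intro sum.cong) auto
      then show ?thesis using j by simp
    qed
    have Qw: "norm (Q L x) \<le> (\<Sum>j < N (k L). norm (c L j) * w L j x)" if x: "x \<in> sphere 0 1" for L x
      unfolding Q_def
    proof (rule sum_norm_le)
      fix j assume "j \<in> {..<N (k L)}"
      then show "norm (c L j * h L j x) \<le> norm (c L j) * w L j x"
        unfolding norm_mult using hw x by (intro mult_left_mono) auto
    qed
    \<comment> \<open>For \<open>p = \<infinity>\<close> the bound \<open>A\<close> on the sum of the weights suffices; for \<open>p < \<infinity>\<close> the factor
      \<open>1 / N L\<close> in their integrals matches the normalization of the data.\<close>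
    have "\<exists>K. \<forall>L. Lp_norm sphere_measure p (Q L) \<le> ennreal K"
    proof (cases "p = \<infinity>")
      case True
      define S where "S = (SUP L. SUP j\<in>{..<N (k L)}. ennreal (norm (c L j)))"
      have S: "S < \<infinity>" using c True by (simp add: Lp_bounded_values_def S_def)
      have cS: "norm (c L j) \<le> enn2real S" if "j < N (k L)" for L j
      proof -
        have "ennreal (norm (c L j)) \<le> S"
          unfolding S_def using that by (intro SUP_upper2[of L] SUP_upper2[of j]) auto
        then have "enn2real (ennreal (norm (c L j))) \<le> enn2real S"
          using S by (intro enn2real_mono) (auto simp: less_top)
        then show ?thesis by simp
      qed
      have "Lp_norm sphere_measure p (Q L) \<le> ennreal (enn2real S * A)" for L
      proof -
        have "ennreal (norm (Q L x)) \<le> ennreal (enn2real S * A)" if x: "x \<in> sphere 0 1" for x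
        proof (rule ennreal_leI)
          have "norm (Q L x) \<le> (\<Sum>j < N (k L). norm (c L j) * w L j x)" by (rule Qw[OF x])
          also have "\<dots> \<le> (\<Sum>j < N (k L). enn2real S * w L j x)"
            using hw cS by (intro sum_mono mult_right_mono) auto
          also have "\<dots> = enn2real S * (\<Sum>j < N (k L). w L j x)" by (simp add: sum_distrib_left)
          also have "\<dots> \<le> enn2real S * A" using hw by (intro mult_left_mono) auto
          finally show "norm (Q L x) \<le> enn2real S * A" .
        qed
        then have "AE x in sphere_measure. ennreal (norm (Q L x)) \<le> ennreal (enn2real S * A)"
          by (intro AE_I2) (simp only: space_sphere_measure)
        moreover have "(\<lambda>x. ennreal (norm (Q L x))) \<in> borel_measurable sphere_measure"
          using sphere_polys_measurable[OF Qp[of L]] by measurable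
        ultimately show ?thesis using True by (simp add: Lp_norm_def esssup_I)
      qed
      then show ?thesis by blast
    next
      case False
      define q where "q = enn2real p"
      have q: "q \<ge> 1" using p False unfolding q_def
        by (metis enn2real_1 enn2real_mono infinity_ennreal_def less_top)
      define S where "S = (SUP L. ennreal ((\<Sum>j<N (k L). norm (c L j) powr q) / real (N L)))"
      have S: "S < \<infinity>" using c False by (simp add: Lp_bounded_values_def S_def q_def N_def)
      define C where "C = enn2real S"
      have cC: "(\<Sum>j<N (k L). norm (c L j) powr q) / real (N L) \<le> C" for L
      proof -
        have "ennreal ((\<Sum>j<N (k L). norm (c L j) powr q) / real (N L)) \<le> S"
          unfolding S_def by (rule SUP_upper) simp
        then have "enn2real (ennreal ((\<Sum>j<N (k L). norm (c L j) powr q) / real (N L))) \<le> C"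
          unfolding C_def using S by (intro enn2real_mono) (auto simp: less_top)
        then show ?thesis by (simp add: sum_nonneg)
      qed
      define K where "K = A powr (q - 1) * (B * C)"
      have K: "K \<ge> 0" using B0 by (simp add: K_def C_def)
      have "Lp_norm sphere_measure p (Q L) \<le> ennreal (K powr (1 / enn2real p))" for L
      proof (rule Lp_norm_le[OF False K])
        have "(\<integral>\<^sup>+x. ennreal (norm (Q L x) powr q) \<partial>sphere_measure)
          \<le> (\<integral>\<^sup>+x. ennreal ((\<Sum>j < N (k L). norm (c L j) * w L j x) powr q) \<partial>sphere_measure)"
          using Qw q by (intro nn_integral_mono ennreal_leI powr_mono2) (auto simp: space_sphere_measure)
        also have "\<dots> \<le> ennreal (A powr (q - 1) * (B / N L * (\<Sum>j < N (k L). norm (c L j) powr q)))"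
        proof (rule nn_integral_weighted_sum_powr_le)
          fix j assume "j \<in> {..<N (k L)}"
          then show "w L j \<in> borel_measurable sphere_measure"
            using hw by (intro measurable_sphere_measure) auto
        qed (use hw q B0 in auto)
        also have "\<dots> \<le> ennreal K"
        proof (rule ennreal_leI)
          have "B / N L * (\<Sum>j < N (k L). norm (c L j) powr q) = B * ((\<Sum>j < N (k L). norm (c L j) powr q) / N L)"
            by simp
          also have "\<dots> \<le> B * C" using B0 cC by (intro mult_left_mono) auto
          finally show "A powr (q - 1) * (B / N L * (\<Sum>j < N (k L). norm (c L j) powr q)) \<le> K"
            unfolding K_def by (intro mult_left_mono) auto
        qed
        finally show "(\<integral>\<^sup>+x. ennreal (norm (Q L x) powr enn2real p) \<partial>sphere_measure) \<le> ennreal K"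
          by (simp add: q_def)
      qed
      then show ?thesis by blast
    qed
    then obtain K where "\<And>L. Lp_norm sphere_measure p (Q L) \<le> ennreal K" by blast
    then have "(SUP L. Lp_norm sphere_measure p (Q L)) \<le> ennreal K" by (intro SUP_least) auto
    also have "\<dots> < \<infinity>" by simp
    finally show ?thesis using Qp Qv by blast
  qed
  with arr N_mono show "Lp_interpolating p (\<lambda>L. sphere_dim TYPE('a) (deg_minus \<epsilon> L)) (\<lambda>L. z (deg_minus \<epsilon> L))"
    unfolding Lp_interpolating_def N_def[symmetric] k_def[symmetric] by blast
qed

end
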